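(* \textsc{Critical Node Cut} is fixed-parameter tractable with respect to the parameter $k+x$; that is, it can be solved in time $f(k+x)\cdot n^{O(1)}$ for some computable function $f$, where $n$ is the number of vertices of the input graph.
   Context: \textsc{Critical Node Cut} (CNC): given an undirected simple graph $G$ and two nonnegative integers $k$ and $x$, decide whether there exists $C\subseteq V(G)$ with $|C|\le k$ such that $G-C$ has at most $x$ connected pairs, where a connected pair is an ordered pair $(u,v)$ of distinct vertices in the same connected component. *)

theory Defs
  imports "Graph_Theory.Digraph_Component"
begin

section \<open>Random access machines\<close>

text \<open>
  The machine model is the RAM of Cook and Reckhow: registers holding natural numbers, a sequential
  read-only input of natural numbers, a finite program, and uniform cost. Addition and subtraction
  are the only arithmetic operations, so the bit length of the largest stored number grows by at
  most one per step, and running times are polynomially related to those of Turing machines.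
  Subtraction is truncated at 0, and reading beyond the end of the input yields 0.
\<close>

datatype instr =
    Const nat nat
  | Add nat nat nat
  | Sub nat nat nat
  | Load nat nat
  | Store nat nat
  | Read nat
  | JumpPos nat nat

text \<open>A configuration consists of the program counter, the unread input, and the registers.\<close>

type_synonym config = "nat \<times> nat list \<times> (nat \<Rightarrow> nat)"

fun exec :: "instr \<Rightarrow> config \<Rightarrow> config" where
  "exec (Const i c) (pc, inp, R) = (Suc pc, inp, R(i := c))"
| "exec (Add i j l) (pc, inp, R) = (Suc pc, inp, R(i := R j + R l))"
| "exec (Sub i j l) (pc, inp, R) = (Suc pc, inp, R(i := R j - R l))"
| "exec (Load i j) (pc, inp, R) = (Suc pc, inp, R(i := R (R j)))"
| "exec (Store i j) (pc, inp, R) = (Suc pc, inp, R(R i := R j))"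
| "exec (Read i) (pc, inp, R) =
    (Suc pc, tl inp, R(i := (case inp of [] \<Rightarrow> 0 | a # _ \<Rightarrow> a)))"
| "exec (JumpPos i m) (pc, inp, R) = (if R i > 0 then m else Suc pc, inp, R)"

text \<open>The machine halts when the program counter leaves the program.\<close>

definition step :: "instr list \<Rightarrow> config \<Rightarrow> config" where
  "step P c = (if fst c < length P then exec (P ! fst c) c else c)"

text \<open>
  On input \<open>w\<close> the program \<open>P\<close> halts after at most \<open>t\<close> steps with \<open>y\<close> in register 0. Halted
  configurations are fixed points of \<open>step\<close>, hence ``at most''.
\<close>

definition computes_in :: "instr list \<Rightarrow> nat list \<Rightarrow> nat \<Rightarrow> nat \<Rightarrow> bool" where
  "computes_in P w t y \<longleftrightarrow>
    (\<exists>pc inp R. (step P ^^ t) (0, w, \<lambda>_. 0) = (pc, inp, R) \<and> length P \<le> pc \<and> R 0 = y)"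

definition computable :: "(nat \<Rightarrow> nat) \<Rightarrow> bool" where
  "computable f \<longleftrightarrow> (\<exists>P. \<forall>a. \<exists>t. computes_in P [a] t (f a))"


section \<open>Fixed-parameter tractability\<close>

text \<open>
  A parameterized decision problem is given by its set \<open>I\<close> of instances, the machine encoding
  \<open>enc\<close>, the parameter \<open>par\<close>, the size measure \<open>sz\<close> and the set \<open>Yes\<close> of yes-instances. The
  polynomial factor is written with \<open>sz i + 1\<close> so that it does not vanish on instances of size 0;
  for \<open>sz i \<ge> 1\<close> we have \<open>(sz i + 1) ^ c \<le> 2 ^ c * sz i ^ c\<close>, and \<open>f\<close> absorbs the constant.
\<close>

definition fixed_parameter_tractable ::
  "'i set \<Rightarrow> ('i \<Rightarrow> nat list) \<Rightarrow> ('i \<Rightarrow> nat) \<Rightarrow> ('i \<Rightarrow> nat) \<Rightarrow> 'i set \<Rightarrow> bool" where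
  "fixed_parameter_tractable I enc par sz Yes \<longleftrightarrow>
    (\<exists>P f c. computable f \<and>
      (\<forall>i\<in>I. computes_in P (enc i) (f (par i) * (sz i + 1) ^ c) (if i \<in> Yes then 1 else 0)))"


section \<open>Critical Node Cut\<close>

text \<open>
  Undirected simple graphs are finite symmetric loop-free digraphs without parallel arcs
  (\<open>pair_graph\<close>); the connected components of such a graph are its strongly connected components
  \<open>pre_digraph.sccs\<close>.
\<close>

definition connected_pairs :: "('a, 'b) pre_digraph \<Rightarrow> ('a \<times> 'a) set" where
  "connected_pairs H = {(u, v). u \<noteq> v \<and> (\<exists>K \<in> pre_digraph.sccs H. u \<in> verts K \<and> v \<in> verts K)}"

text \<open>As an input to a machine, a graph on \<open>n\<close> vertices has vertex set \<open>{0, ..., n - 1}\<close>.\<close>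

type_synonym cnc_instance = "nat pair_pre_digraph \<times> nat \<times> nat"

definition cnc_instances :: "cnc_instance set" where
  "cnc_instances = {(G, k, x). pair_graph G \<and> pverts G = {..<card (pverts G)}}"

definition cnc :: "cnc_instance set" where
  "cnc = {(G, k, x) \<in> cnc_instances. \<exists>C \<subseteq> pverts G. card C \<le> k \<and>
    card (connected_pairs (with_proj G \<restriction> (pverts G - C))) \<le> x}"

fun cnc_size :: "cnc_instance \<Rightarrow> nat" where
  "cnc_size (G, k, x) = card (pverts G)"

fun cnc_parameter :: "cnc_instance \<Rightarrow> nat" where
  "cnc_parameter (G, k, x) = k + x"

text \<open>The number of vertices, \<open>k\<close>, \<open>x\<close>, and the adjacency matrix row by row.\<close>

fun cnc_encode :: "cnc_instance \<Rightarrow> nat list" where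
  "cnc_encode (G, k, x) =
    (let n = card (pverts G) in
      n # k # x # [if (u, v) \<in> parcs G then 1 else 0. u \<leftarrow> [0..<n], v \<leftarrow> [0..<n]])"

end

theory Submission
  imports Defs
begin

text \<open>
  Pick an edge between undeleted vertices that are not both marked as kept. A solution \<open>C\<close> contains
  the first end, or contains the second end, or avoids both. In the first two cases delete that end,
  in the third mark both ends as kept. Every vertex kept in agreement with \<open>C\<close> has a neighbour in
  \<open>G - C\<close> and hence is the first component of a connected pair, so at most \<open>x\<close> vertices are kept and
  at most \<open>k\<close> deleted: \<open>k + x\<close> ternary decisions suffice. When no edge is left to decide, the
  connected pairs of the remaining graph live on kept vertices and are connected pairs of \<open>G - C\<close>.
  Trying all \<open>3 ^ (k + x)\<close> decision strings and counting the connected pairs that remain for each is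
  fixed-parameter tractable. Since the outcome of every string is checked, a wrong string does no harm.

  The machine code is compiled from a language whose only loops run a number of times fixed on entry,
  so that semantics and running time are total recursive functions on programs.
\<close>

section \<open>Loop programs\<close>

text \<open>The number of vertices avoiding a solution \<open>C\<close> is not bounded by
  \<open>k + x\<close>, because vertices isolated in \<open>G - C\<close> lie in no connected pair.
  Hence the branching is on edges, and the third branch keeps a whole edge at once: this is what
  makes each kept vertex chargeable to a connected pair. Progress is measured by
  \<open>|C - D| + |U - F|\<close>, where \<open>U\<close> is the set of vertices that are not
  isolated in \<open>G - C\<close>. Every decision made in accordance with \<open>C\<close> lowers
  this sum, since edges already settled consume no decision. Loop programs have no recursion, so the
  search tree is replaced by an enumeration of its branches, coded as numbers in base 3. The machine
  can neither multiply nor divide, so digits are read off by comparison with tabulated powers of 3.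
  The exponent 4 of the polynomial factor comes from the component labels: there are at most
  \<open>n^2\<close> arcs, and the arc list is traversed as many times as it has arcs.\<close>

datatype expr =
    Num nat
  | Var nat
  | Arr nat expr
  | Plus expr expr
  | Minus expr expr

datatype prog =
    Assign nat expr
  | Update nat expr expr
  | Input nat
  | Seq prog prog (infixr ";;" 60)
  | When expr prog
  | Repeat nat prog

record env =
  inp :: "nat list"
  var :: "nat \<Rightarrow> nat"
  arr :: "nat \<Rightarrow> nat \<Rightarrow> nat"

primrec aval :: "expr \<Rightarrow> env \<Rightarrow> nat" where
  "aval (Num c) s = c"
| "aval (Var x) s = var s x"
| "aval (Arr j e) s = arr s j (aval e s)"
| "aval (Plus a b) s = aval a s + aval b s"
| "aval (Minus a b) s = aval a s - aval b s"

primrec sem :: "prog \<Rightarrow> env \<Rightarrow> env" where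
  "sem (Assign x e) s = s\<lparr>var := (var s)(x := aval e s)\<rparr>"
| "sem (Update j i e) s = s\<lparr>arr := (arr s)(j := (arr s j)(aval i s := aval e s))\<rparr>"
| "sem (Input x) s =
    s\<lparr>inp := tl (inp s), var := (var s)(x := (case inp s of [] \<Rightarrow> 0 | a # _ \<Rightarrow> a))\<rparr>"
| "sem (p ;; q) s = sem q (sem p s)"
| "sem (When e p) s = (if aval e s > 0 then sem p s else s)"
| "sem (Repeat x p) s = (sem p ^^ var s x) s"

text \<open>Expressions compile to straight-line code, so this is both the length of that code and
  its number of steps. Copying a register takes two instructions, \<open>Const\<close> and
  \<open>Add\<close>; an array access takes five to form the address and one
  \<open>Load\<close>.\<close>

primrec ecost :: "expr \<Rightarrow> nat" where
  "ecost (Num c) = 1"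
| "ecost (Var x) = 2"
| "ecost (Arr j e) = ecost e + 6"
| "ecost (Plus a b) = ecost a + ecost b + 1"
| "ecost (Minus a b) = ecost a + ecost b + 1"

text \<open>An exact step count, not an estimate. With no unconditional jump available, skipping a
  body takes three instructions: a failed test, setting a register to 1, and a jump on it. A loop
  spends 2 steps on copying its counter, 1 + 3 per round besides the body, and 3 on leaving.\<close>

primrec cost :: "prog \<Rightarrow> env \<Rightarrow> nat" where
  "cost (Assign x e) s = ecost e + 2"
| "cost (Update j i e) s = ecost i + ecost e + 6"
| "cost (Input x) s = 1"
| "cost (p ;; q) s = cost p s + cost q (sem p s)"
| "cost (When e p) s = ecost e + (if aval e s > 0 then cost p s + 1 else 3)"
| "cost (Repeat x p) s = (\<Sum>i<var s x. cost p ((sem p ^^ i) s) + 4) + 5"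

primrec loop_vars :: "prog \<Rightarrow> nat set" where
  "loop_vars (Assign x e) = {}"
| "loop_vars (Update j i e) = {}"
| "loop_vars (Input x) = {}"
| "loop_vars (p ;; q) = loop_vars p \<union> loop_vars q"
| "loop_vars (When e p) = loop_vars p"
| "loop_vars (Repeat x p) = insert x (loop_vars p)"

primrec assigned :: "prog \<Rightarrow> nat set" where
  "assigned (Assign x e) = {x}"
| "assigned (Update j i e) = {}"
| "assigned (Input x) = {x}"
| "assigned (p ;; q) = assigned p \<union> assigned q"
| "assigned (When e p) = assigned p"
| "assigned (Repeat x p) = assigned p"

primrec cost_bound :: "prog \<Rightarrow> (nat \<Rightarrow> nat) \<Rightarrow> nat" where
  "cost_bound (Assign x e) V = ecost e + 2"
| "cost_bound (Update j i e) V = ecost i + ecost e + 6"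
| "cost_bound (Input x) V = 1"
| "cost_bound (p ;; q) V = cost_bound p V + cost_bound q V"
| "cost_bound (When e p) V = ecost e + 3 + cost_bound p V"
| "cost_bound (Repeat x p) V = V x * (cost_bound p V + 4) + 5"

primrec updated :: "prog \<Rightarrow> nat set" where
  "updated (Assign x e) = {}"
| "updated (Update j i e) = {j}"
| "updated (Input x) = {}"
| "updated (p ;; q) = updated p \<union> updated q"
| "updated (When e p) = updated p"
| "updated (Repeat x p) = updated p"

primrec loop_depth :: "prog \<Rightarrow> nat" where
  "loop_depth (Assign x e) = 0"
| "loop_depth (Update j i e) = 0"
| "loop_depth (Input x) = 0"
| "loop_depth (p ;; q) = max (loop_depth p) (loop_depth q)"
| "loop_depth (When e p) = loop_depth p"
| "loop_depth (Repeat x p) = Suc (loop_depth p)"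

section \<open>Frame properties and syntactic bounds on the cost\<close>

lemma arr_sem_unupdated: "j \<notin> updated p \<Longrightarrow> arr (sem p s) j = arr s j"
proof (induction p arbitrary: s)
  case (Repeat y p)
  have "arr ((sem p ^^ i) s) j = arr s j" for i
    by (induction i) (use Repeat in auto)
  then show ?case by simp
qed auto

lemma var_sem_unassigned: "x \<notin> assigned p \<Longrightarrow> var (sem p s) x = var s x"
proof (induction p arbitrary: s)
  case (Repeat y p)
  have "var ((sem p ^^ i) s) x = var s x" for i
    by (induction i) (use Repeat in auto)
  then show ?case by simp
qed auto

lemma cost_bound_cong: "(\<And>x. x \<in> loop_vars p \<Longrightarrow> V x = W x) \<Longrightarrow> cost_bound p V = cost_bound p W"
  by (induction p) auto

text \<open>As no loop variable is ever assigned, all intermediate states agree on the iteration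
  counts, and evaluating \<open>cost_bound\<close> in the entry state is enough.\<close>

lemma cost_le_cost_bound:
  "assigned p \<inter> loop_vars p = {} \<Longrightarrow> cost p s \<le> cost_bound p (var s)"
proof (induction p arbitrary: s)
  case (Seq p q)
  have "cost_bound q (var (sem p s)) = cost_bound q (var s)"
    by (rule cost_bound_cong, rule var_sem_unassigned) (use Seq.prems in auto)
  moreover have "cost p s \<le> cost_bound p (var s)" "cost q (sem p s) \<le> cost_bound q (var (sem p s))"
    using Seq by auto
  ultimately show ?case by simp
next
  case (When e p)
  then have "cost p s \<le> cost_bound p (var s)" by simp
  then show ?case by simp
next
  case (Repeat y p)
  have unchanged: "x \<notin> assigned p \<Longrightarrow> var ((sem p ^^ i) s) x = var s x" for i x
    by (induction i) (auto simp: var_sem_unassigned)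
  have "cost p ((sem p ^^ i) s) \<le> cost_bound p (var s)" for i
  proof -
    have "cost p ((sem p ^^ i) s) \<le> cost_bound p (var ((sem p ^^ i) s))"
      using Repeat by auto
    also have "\<dots> = cost_bound p (var s)"
      by (rule cost_bound_cong, rule unchanged) (use Repeat.prems in auto)
    finally show ?thesis .
  qed
  then have "(\<Sum>i<var s y. cost p ((sem p ^^ i) s) + 4) \<le> (\<Sum>i<var s y. cost_bound p (var s) + 4)"
    by (intro sum_mono) auto
  then show ?case by simp
qed auto

text \<open>Each level of nesting contributes one factor \<open>M\<close>. Since \<open>M\<close> is
  positive, lower powers are absorbed into the highest one, and the coefficient left over is the
  bound for loops that run once.\<close>

lemma cost_bound_le_power:
  assumes "\<And>x. x \<in> loop_vars p \<Longrightarrow> V x \<le> M" "0 < M"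
  shows "cost_bound p V \<le> cost_bound p (\<lambda>_. 1) * M ^ loop_depth p"
  using assms(1)
proof (induction p)
  case (Seq p q)
  have "cost_bound p V \<le> cost_bound p (\<lambda>_. 1) * M ^ max (loop_depth p) (loop_depth q)"
    by (rule order_trans[OF Seq.IH(1)])
      (use Seq.prems assms(2) in \<open>auto intro!: mult_left_mono power_increasing\<close>)
  moreover have "cost_bound q V \<le> cost_bound q (\<lambda>_. 1) * M ^ max (loop_depth p) (loop_depth q)"
    by (rule order_trans[OF Seq.IH(2)])
      (use Seq.prems assms(2) in \<open>auto intro!: mult_left_mono power_increasing\<close>)
  ultimately show ?case by (simp add: distrib_right)
next
  case (When e p)
  have "ecost e + 3 \<le> (ecost e + 3) * M ^ loop_depth p" using assms(2) by simp
  then show ?case using When by (simp add: distrib_right add_mono)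
next
  case (Repeat x p)
  have "V x * (cost_bound p V + 4) \<le> M * (cost_bound p (\<lambda>_. 1) * M ^ loop_depth p + 4 * M ^ loop_depth p)"
    using Repeat assms(2) by (intro mult_mono add_mono) auto
  moreover have "5 \<le> 5 * M ^ Suc (loop_depth p)" using assms(2) by simp
  ultimately have "V x * (cost_bound p V + 4) + 5 \<le>
      M * (cost_bound p (\<lambda>_. 1) * M ^ loop_depth p + 4 * M ^ loop_depth p) + 5 * M ^ Suc (loop_depth p)"
    by (rule add_mono)
  then show ?case by (simp add: algebra_simps)
qed (use assms(2) in auto)


section \<open>Compilation to random access machines\<close>

text \<open>
  Cell \<open>i\<close> of array \<open>j < 6\<close> lives in register \<open>8 * i + j\<close>, variable \<open>x\<close> in \<open>8 * x + 6\<close>, and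
  temporary \<open>d\<close> in \<open>8 * d + 7\<close>. Code compiled at depth \<open>d\<close> leaves the temporaries below \<open>d\<close> alone;
  there the enclosing loops keep their counters.
\<close>

definition cell :: "nat \<Rightarrow> nat \<Rightarrow> nat" where "cell j i = 8 * i + j"
definition vreg :: "nat \<Rightarrow> nat" where "vreg x = 8 * x + 6"
definition treg :: "nat \<Rightarrow> nat" where "treg d = 8 * d + 7"

lemma vreg_eq_iff [simp]: "vreg x = vreg y \<longleftrightarrow> x = y"
  by (simp add: vreg_def)

lemma treg_eq_iff [simp]: "treg d = treg e \<longleftrightarrow> d = e"
  by (simp add: treg_def)

lemma vreg_neq_treg [simp]: "vreg x \<noteq> treg d" "treg d \<noteq> vreg x"
  unfolding vreg_def treg_def by presburger+

lemma cell_eq_iff: "j < 6 \<Longrightarrow> l < 6 \<Longrightarrow> cell j i = cell l k \<longleftrightarrow> j = l \<and> i = k"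
  unfolding cell_def by presburger

lemma cell_neq [simp]:
  assumes "j < 6"
  shows "cell j i \<noteq> treg d" "treg d \<noteq> cell j i" "cell j i \<noteq> vreg x" "vreg x \<noteq> cell j i"
  using assms unfolding cell_def treg_def vreg_def by presburger+

text \<open>Three doublings stand in for the multiplication by 8 in the address of an array cell;
  the next temporary is overwritten with the array number.\<close>

definition cell_code :: "nat \<Rightarrow> nat \<Rightarrow> instr list" where
  "cell_code j d =
    [Add (treg d) (treg d) (treg d), Add (treg d) (treg d) (treg d), Add (treg d) (treg d) (treg d),
     Const (treg (Suc d)) j, Add (treg d) (treg d) (treg (Suc d))]"

primrec expr_code :: "expr \<Rightarrow> nat \<Rightarrow> instr list" where
  "expr_code (Num c) d = [Const (treg d) c]"
| "expr_code (Var x) d = [Const (treg d) 0, Add (treg d) (treg d) (vreg x)]"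
| "expr_code (Arr j e) d = expr_code e d @ cell_code j d @ [Load (treg d) (treg d)]"
| "expr_code (Plus a b) d =
    expr_code a d @ expr_code b (Suc d) @ [Add (treg d) (treg d) (treg (Suc d))]"
| "expr_code (Minus a b) d =
    expr_code a d @ expr_code b (Suc d) @ [Sub (treg d) (treg d) (treg (Suc d))]"

text \<open>Jump targets are absolute, so the length of a body must be known before its code is
  generated; it depends on neither the address nor the depth.\<close>

primrec code_length :: "prog \<Rightarrow> nat" where
  "code_length (Assign x e) = ecost e + 2"
| "code_length (Update j i e) = ecost i + ecost e + 6"
| "code_length (Input x) = 1"
| "code_length (p ;; q) = code_length p + code_length q"
| "code_length (When e p) = ecost e + code_length p + 3"
| "code_length (Repeat x p) = code_length p + 8"

text \<open>\<open>code p a d\<close> is meant to be placed at address \<open>a\<close>; jump targets are absolute.\<close>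

primrec code :: "prog \<Rightarrow> nat \<Rightarrow> nat \<Rightarrow> instr list" where
  "code (Assign x e) a d = expr_code e d @ [Const (vreg x) 0, Add (vreg x) (vreg x) (treg d)]"
| "code (Update j i e) a d =
    expr_code i d @ cell_code j d @ expr_code e (Suc d) @ [Store (treg d) (treg (Suc d))]"
| "code (Input x) a d = [Read (vreg x)]"
| "code (p ;; q) a d = code p a d @ code q (a + code_length p) d"
| "code (When e p) a d =
    expr_code e d @
    [JumpPos (treg d) (a + ecost e + 3), Const (treg d) 1,
     JumpPos (treg d) (a + ecost e + 3 + code_length p)] @
    code p (a + ecost e + 3) d"
| "code (Repeat x p) a d =
    [Const (treg d) 0, Add (treg d) (treg d) (vreg x),
     JumpPos (treg d) (a + 5), Const (treg (Suc d)) 1,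
     JumpPos (treg (Suc d)) (a + code_length p + 8)] @
    code p (a + 5) (Suc d) @
    [Const (treg (Suc d)) 1, Sub (treg d) (treg d) (treg (Suc d)), JumpPos (treg (Suc d)) (a + 2)]"

primrec expr_ok :: "expr \<Rightarrow> bool" where
  "expr_ok (Num c) = True"
| "expr_ok (Var x) = True"
| "expr_ok (Arr j e) = (j < 6 \<and> expr_ok e)"
| "expr_ok (Plus a b) = (expr_ok a \<and> expr_ok b)"
| "expr_ok (Minus a b) = (expr_ok a \<and> expr_ok b)"

primrec prog_ok :: "prog \<Rightarrow> bool" where
  "prog_ok (Assign x e) = expr_ok e"
| "prog_ok (Update j i e) = (j < 6 \<and> expr_ok i \<and> expr_ok e)"
| "prog_ok (Input x) = True"
| "prog_ok (p ;; q) = (prog_ok p \<and> prog_ok q)"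
| "prog_ok (When e p) = (expr_ok e \<and> prog_ok p)"
| "prog_ok (Repeat x p) = prog_ok p"

lemma length_cell_code [simp]: "length (cell_code j d) = 5"
  by (simp add: cell_code_def)

lemma length_expr_code [simp]: "length (expr_code e d) = ecost e"
  by (induction e arbitrary: d) auto

lemma length_code [simp]: "length (code p a d) = code_length p"
  by (induction p arbitrary: a d) auto

section \<open>Simulation of loop programs on the machine\<close>

definition represents :: "(nat \<Rightarrow> nat) \<Rightarrow> env \<Rightarrow> bool" where
  "represents R s \<longleftrightarrow> (\<forall>x. R (vreg x) = var s x) \<and> (\<forall>j<6. \<forall>i. R (cell j i) = arr s j i)"

definition agree_below :: "nat \<Rightarrow> (nat \<Rightarrow> nat) \<Rightarrow> (nat \<Rightarrow> nat) \<Rightarrow> bool" where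
  "agree_below d R R' \<longleftrightarrow> (\<forall>i<d. R' (treg i) = R (treg i))"

definition code_at :: "instr list \<Rightarrow> nat \<Rightarrow> instr list \<Rightarrow> bool" where
  "code_at P a is \<longleftrightarrow> (\<forall>i<length is. a + i < length P \<and> P ! (a + i) = is ! i)"

definition runs :: "instr list \<Rightarrow> nat \<Rightarrow> config \<Rightarrow> config \<Rightarrow> bool" where
  "runs P t c c' \<longleftrightarrow> (step P ^^ t) c = c'"

lemma code_at_Nil [simp]: "code_at P a []"
  by (simp add: code_at_def)

lemma code_at_Cons [simp]:
  "code_at P a (i # is) \<longleftrightarrow> a < length P \<and> P ! a = i \<and> code_at P (Suc a) is"
  by (force simp: code_at_def nth_Cons less_Suc_eq_0_disj split: nat.splits)

lemma code_at_append [simp]: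
  "code_at P a (is @ js) \<longleftrightarrow> code_at P a is \<and> code_at P (a + length is) js"
  by (induction "is" arbitrary: a) auto

lemma runs_0 [simp]: "runs P 0 c c' \<longleftrightarrow> c = c'"
  by (simp add: runs_def)

lemma runs_trans: "runs P t c c' \<Longrightarrow> runs P t' c' c'' \<Longrightarrow> runs P (t + t') c c''"
  unfolding runs_def by (subst add.commute) (simp add: funpow_add)

lemma runs_Suc [simp]:
  "a < length P \<Longrightarrow> runs P (Suc t) (a, w, R) c \<longleftrightarrow> runs P t (exec (P ! a) (a, w, R)) c"
  by (simp add: runs_def step_def funpow_Suc_right del: funpow.simps)

lemma represents_treg [simp]: "represents (R(treg d := v)) s \<longleftrightarrow> represents R s"
  by (auto simp: represents_def)

lemma represents_vreg:
  "represents R s \<Longrightarrow> represents (R(vreg x := v)) (s\<lparr>inp := w, var := (var s)(x := v)\<rparr>)"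
  by (auto simp: represents_def cell_eq_iff)

lemma represents_cell:
  "represents R s \<Longrightarrow> j < 6 \<Longrightarrow>
    represents (R(cell j i := v)) (s\<lparr>arr := (arr s)(j := (arr s j)(i := v))\<rparr>)"
  by (auto simp: represents_def cell_eq_iff)

lemma agree_below_refl [simp]: "agree_below d R R"
  by (simp add: agree_below_def)

lemma agree_below_trans: "agree_below d R R' \<Longrightarrow> agree_below d R' R'' \<Longrightarrow> agree_below d R R''"
  by (simp add: agree_below_def)

lemma agree_below_mono: "agree_below d R R' \<Longrightarrow> d' \<le> d \<Longrightarrow> agree_below d' R R'"
  by (simp add: agree_below_def)

lemma agree_below_treg [simp]:
  "d \<le> e \<Longrightarrow> agree_below d R (R'(treg e := v)) \<longleftrightarrow> agree_below d R R'"
  "d \<le> e \<Longrightarrow> agree_below d (R(treg e := v)) R' \<longleftrightarrow> agree_below d R R'"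
  by (auto simp: agree_below_def)

lemma agree_below_other [simp]:
  "agree_below d R (R'(vreg x := v)) \<longleftrightarrow> agree_below d R R'"
  "j < 6 \<Longrightarrow> agree_below d R (R'(cell j i := v)) \<longleftrightarrow> agree_below d R R'"
  by (auto simp: agree_below_def)

lemma runs_cell_code:
  assumes "code_at P a (cell_code j d)"
  shows "runs P 5 (a, w, R) (a + 5, w, R(treg d := cell j (R (treg d)), treg (Suc d) := j))"
proof -
  have "runs P (Suc (Suc (Suc (Suc (Suc 0))))) (a, w, R)
      (Suc (Suc (Suc (Suc (Suc a)))), w, R(treg d := cell j (R (treg d)), treg (Suc d) := j))"
    using assms unfolding cell_code_def
    by (auto simp: fun_upd_twist cell_def intro!: arg_cong2[where f = "fun_upd _"])
  then show ?thesis by (simp add: eval_nat_numeral)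
qed

text \<open>The left operand waits in \<open>treg d\<close> while the right one is evaluated at
  depth \<open>Suc d\<close>. The conclusion \<open>agree_below\<close> is what preserves it, so it
  must be carried through the induction.\<close>

lemma runs_expr_code:
  assumes "expr_ok e" "represents R s" "code_at P a (expr_code e d)"
  shows "\<exists>R'. runs P (ecost e) (a, w, R) (a + ecost e, w, R') \<and>
    represents R' s \<and> agree_below d R R' \<and> R' (treg d) = aval e s"
  using assms
proof (induction e arbitrary: R a d)
  case (Num c)
  then have "runs P (Suc 0) (a, w, R) (a + 1, w, R(treg d := c))"
    by auto
  then have "runs P (ecost (Num c)) (a, w, R) (a + ecost (Num c), w, R(treg d := c))" by simp
  moreover have "represents (R(treg d := c)) s" using Num by simp
  moreover have "agree_below d R (R(treg d := c))" by simp
  moreover have "(R(treg d := c)) (treg d) = aval (Num c) s" by simp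
  ultimately show ?case by blast
next
  case (Var x)
  let ?R = "R(treg d := R (vreg x))"
  have "runs P 2 (a, w, R) (a + 2, w, ?R)"
    using Var unfolding numeral_2_eq_2
    by auto
  then have "runs P (ecost (Var x)) (a, w, R) (a + ecost (Var x), w, ?R)" by simp
  moreover have "represents ?R s" using Var by simp
  moreover have "agree_below d R ?R" by simp
  moreover have "?R (treg d) = aval (Var x) s" using Var by (simp add: represents_def)
  ultimately show ?case by blast
next
  case (Arr j e)
  then obtain R1 where R1: "runs P (ecost e) (a, w, R) (a + ecost e, w, R1)"
    "represents R1 s" "agree_below d R R1" "R1 (treg d) = aval e s"
    by fastforce
  define R2 where "R2 = R1(treg d := cell j (aval e s), treg (Suc d) := j)"
  have R2: "runs P 5 (a + ecost e, w, R1) (a + ecost e + 5, w, R2)"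
    unfolding R2_def R1(4)[symmetric] by (rule runs_cell_code) (use Arr in simp)
  let ?R = "R2(treg d := R2 (R2 (treg d)))"
  have "runs P (Suc 0) (a + ecost e + 5, w, R2) (a + ecost e + 6, w, ?R)"
    using Arr by auto
  from runs_trans[OF runs_trans[OF R1(1) R2] this]
  have "runs P (ecost (Arr j e)) (a, w, R) (a + ecost (Arr j e), w, ?R)"
    by (simp add: ac_simps)
  moreover have "represents ?R s" using R1(2) by (simp add: R2_def)
  moreover have "agree_below d R ?R" using R1(3) by (simp add: R2_def)
  moreover have "?R (treg d) = aval (Arr j e) s"
    using R1(2) Arr.prems(1) by (auto simp: R2_def represents_def)
  ultimately show ?case by blast
next
  case (Plus e f)
  then obtain R1 where R1: "runs P (ecost e) (a, w, R) (a + ecost e, w, R1)"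
    "represents R1 s" "agree_below d R R1" "R1 (treg d) = aval e s"
    by fastforce
  then obtain R2 where R2: "runs P (ecost f) (a + ecost e, w, R1) (a + ecost e + ecost f, w, R2)"
    "represents R2 s" "agree_below (Suc d) R1 R2" "R2 (treg (Suc d)) = aval f s"
    using Plus.IH(2)[of R1 "a + ecost e" "Suc d"] Plus.prems by auto
  let ?R = "R2(treg d := aval e s + aval f s)"
  have "R2 (treg d) = aval e s"
    using R1(4) R2(3) by (simp add: agree_below_def)
  then have "runs P (Suc 0) (a + ecost e + ecost f, w, R2) (a + ecost e + ecost f + 1, w, ?R)"
    using Plus.prems R2(4) by auto
  from runs_trans[OF runs_trans[OF R1(1) R2(1)] this]
  have "runs P (ecost (Plus e f)) (a, w, R) (a + ecost (Plus e f), w, ?R)" by (simp add: add.assoc)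
  moreover have "represents ?R s" using R2(2) by simp
  moreover have "agree_below d R ?R"
    using agree_below_trans[OF R1(3) agree_below_mono[OF R2(3)]] by simp
  moreover have "?R (treg d) = aval (Plus e f) s" by simp
  ultimately show ?case by blast
next
  case (Minus e f)
  then obtain R1 where R1: "runs P (ecost e) (a, w, R) (a + ecost e, w, R1)"
    "represents R1 s" "agree_below d R R1" "R1 (treg d) = aval e s"
    by fastforce
  then obtain R2 where R2: "runs P (ecost f) (a + ecost e, w, R1) (a + ecost e + ecost f, w, R2)"
    "represents R2 s" "agree_below (Suc d) R1 R2" "R2 (treg (Suc d)) = aval f s"
    using Minus.IH(2)[of R1 "a + ecost e" "Suc d"] Minus.prems by auto
  let ?R = "R2(treg d := aval e s - aval f s)"
  have "R2 (treg d) = aval e s"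
    using R1(4) R2(3) by (simp add: agree_below_def)
  then have "runs P (Suc 0) (a + ecost e + ecost f, w, R2) (a + ecost e + ecost f + 1, w, ?R)"
    using Minus.prems R2(4) by auto
  from runs_trans[OF runs_trans[OF R1(1) R2(1)] this]
  have "runs P (ecost (Minus e f)) (a, w, R) (a + ecost (Minus e f), w, ?R)" by (simp add: add.assoc)
  moreover have "represents ?R s" using R2(2) by simp
  moreover have "agree_below d R ?R"
    using agree_below_trans[OF R1(3) agree_below_mono[OF R2(3)]] by simp
  moreover have "?R (treg d) = aval (Minus e f) s" by simp
  ultimately show ?case by blast
qed

theorem runs_code:
  assumes "prog_ok p" "represents R s" "code_at P a (code p a d)"
  shows "\<exists>R'. runs P (cost p s) (a, inp s, R) (a + code_length p, inp (sem p s), R') \<and>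
    represents R' (sem p s) \<and> agree_below d R R'"
  using assms
proof (induction p arbitrary: R s a d)
  case (Assign x e)
  then obtain R1 where R1: "runs P (ecost e) (a, inp s, R) (a + ecost e, inp s, R1)"
    "represents R1 s" "agree_below d R R1" "R1 (treg d) = aval e s"
    using runs_expr_code[of e R s P a d] by fastforce
  let ?R = "R1(vreg x := aval e s)"
  have "runs P 2 (a + ecost e, inp s, R1) (a + ecost e + 2, inp s, ?R)"
    using Assign R1(4) unfolding numeral_2_eq_2
    by auto
  from runs_trans[OF R1(1) this]
  have "runs P (cost (Assign x e) s) (a, inp s, R)
      (a + code_length (Assign x e), inp (sem (Assign x e) s), ?R)"
    by simp
  moreover have "represents ?R (sem (Assign x e) s)"
    using represents_vreg[OF R1(2), of x "aval e s" "inp s"] by simp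
  moreover have "agree_below d R ?R" using R1(3) by simp
  ultimately show ?case by blast
next
  case (Update j i e)
  then obtain R1 where R1: "runs P (ecost i) (a, inp s, R) (a + ecost i, inp s, R1)"
    "represents R1 s" "agree_below d R R1" "R1 (treg d) = aval i s"
    using runs_expr_code[of i R s P a d] by fastforce
  define R2 where "R2 = R1(treg d := cell j (aval i s), treg (Suc d) := j)"
  have R2: "runs P 5 (a + ecost i, inp s, R1) (a + ecost i + 5, inp s, R2)"
    unfolding R2_def R1(4)[symmetric] by (rule runs_cell_code) (use Update in simp)
  have "represents R2 s" using R1 by (simp add: R2_def)
  then obtain R3 where R3:
    "runs P (ecost e) (a + ecost i + 5, inp s, R2) (a + ecost i + 5 + ecost e, inp s, R3)"
    "represents R3 s" "agree_below (Suc d) R2 R3" "R3 (treg (Suc d)) = aval e s"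
    using runs_expr_code[of e R2 s P "a + ecost i + 5" "Suc d"] Update by fastforce
  let ?R = "R3(cell j (aval i s) := aval e s)"
  have "R3 (treg d) = cell j (aval i s)"
    using R3(3) by (simp add: agree_below_def R2_def)
  then have "runs P (Suc 0) (a + ecost i + 5 + ecost e, inp s, R3)
      (a + ecost i + 5 + ecost e + 1, inp s, ?R)"
    using Update.prems R3(4) by auto
  from runs_trans[OF runs_trans[OF runs_trans[OF R1(1) R2] R3(1)] this]
  have "runs P (cost (Update j i e) s) (a, inp s, R) (a + code_length (Update j i e), inp s, ?R)"
    by (simp add: algebra_simps)
  then have "runs P (cost (Update j i e) s) (a, inp s, R)
      (a + code_length (Update j i e), inp (sem (Update j i e) s), ?R)"
    by simp
  moreover have "represents ?R (sem (Update j i e) s)"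
    using represents_cell[OF R3(2), of j "aval i s" "aval e s"] Update.prems(1) by simp
  moreover have "agree_below d R ?R"
    using R1(3) agree_below_mono[OF R3(3), of d] Update.prems(1)
    by (auto simp: R2_def agree_below_def)
  ultimately show ?case by blast
next
  case (Input x)
  let ?v = "case inp s of [] \<Rightarrow> 0 | b # _ \<Rightarrow> b"
  have "runs P (Suc 0) (a, inp s, R) (a + 1, tl (inp s), R(vreg x := ?v))"
    using Input by auto
  then have "runs P (cost (Input x) s) (a, inp s, R)
      (a + code_length (Input x), inp (sem (Input x) s), R(vreg x := ?v))"
    by simp
  moreover have "represents (R(vreg x := ?v)) (sem (Input x) s)"
    using represents_vreg[OF Input.prems(2), of x ?v "tl (inp s)"] by simp
  moreover have "agree_below d R (R(vreg x := ?v))" by simp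
  ultimately show ?case by blast
next
  case (Seq p q)
  then obtain R1 where R1: "runs P (cost p s) (a, inp s, R) (a + code_length p, inp (sem p s), R1)"
    "represents R1 (sem p s)" "agree_below d R R1"
    by fastforce
  then obtain R2 where R2: "runs P (cost q (sem p s)) (a + code_length p, inp (sem p s), R1)
      (a + code_length p + code_length q, inp (sem q (sem p s)), R2)"
    "represents R2 (sem q (sem p s))" "agree_below d R1 R2"
    using Seq.IH(2)[of R1 "sem p s" "a + code_length p" d] Seq.prems by auto
  show ?case
    using runs_trans[OF R1(1) R2(1)] R2(2) agree_below_trans[OF R1(3) R2(3)]
    by (auto simp: add.assoc)
next
  case (When e p)
  then obtain R1 where R1: "runs P (ecost e) (a, inp s, R) (a + ecost e, inp s, R1)"
    "represents R1 s" "agree_below d R R1" "R1 (treg d) = aval e s"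
    using runs_expr_code[of e R s P a d] by fastforce
  show ?case
  proof (cases "aval e s > 0")
    case True
    have "runs P (Suc 0) (a + ecost e, inp s, R1) (a + ecost e + 3, inp s, R1)"
      using When True R1(4) by auto
    note jump = runs_trans[OF R1(1) this]
    obtain R2 where R2: "runs P (cost p s) (a + ecost e + 3, inp s, R1)
        (a + ecost e + 3 + code_length p, inp (sem p s), R2)"
      "represents R2 (sem p s)" "agree_below d R1 R2"
      using When.IH[of R1 s "a + ecost e + 3" d] When.prems R1 by (auto simp: eval_nat_numeral)
    show ?thesis
      using runs_trans[OF jump R2(1)] R2(2) agree_below_trans[OF R1(3) R2(3)] True
      by (auto simp: add_ac)
  next
    case False
    let ?R = "R1(treg d := 1)"
    have "runs P (Suc (Suc (Suc 0))) (a + ecost e, inp s, R1)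
        (a + ecost e + 3 + code_length p, inp s, ?R)"
      using When False R1(4) by simp
    from runs_trans[OF R1(1) this]
    have "runs P (cost (When e p) s) (a, inp s, R)
        (a + code_length (When e p), inp (sem (When e p) s), ?R)"
      using False by (simp add: add_ac numeral_3_eq_3)
    moreover have "represents ?R (sem (When e p) s)" using R1(2) False by simp
    moreover have "agree_below d R ?R" using R1(3) by simp
    ultimately show ?thesis by blast
  qed
next
  case (Repeat x p)
  let ?s = "\<lambda>i. (sem p ^^ i) s"
  let ?N = "var s x"
  \<comment> \<open>The invariant is taken at the loop head \<open>a + 2\<close>. The counter in
    \<open>treg d\<close> is a private copy of the loop variable and counts down; the body, compiled
    at depth \<open>Suc d\<close>, cannot touch it.\<close>
  have loop: "\<exists>R'. runs P (2 + (\<Sum>i<n. cost p (?s i) + 4)) (a, inp s, R) (a + 2, inp (?s n), R') \<and>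
      represents R' (?s n) \<and> agree_below d R R' \<and> R' (treg d) = ?N - n" if "n \<le> ?N" for n
    using that
  proof (induction n)
    case 0
    let ?R = "R(treg d := R (vreg x))"
    have "runs P 2 (a, inp s, R) (a + 2, inp s, ?R)"
      using Repeat.prems unfolding numeral_2_eq_2
      by auto
    then have "runs P (2 + (\<Sum>i<0. cost p (?s i) + 4)) (a, inp s, R) (a + 2, inp (?s 0), ?R)"
      by simp
    moreover have "represents ?R (?s 0)" using Repeat.prems by simp
    moreover have "agree_below d R ?R" by simp
    moreover have "?R (treg d) = ?N - 0" using Repeat.prems by (simp add: represents_def)
    ultimately show ?case by blast
  next
    case (Suc n)
    then obtain R1 where R1:
      "runs P (2 + (\<Sum>i<n. cost p (?s i) + 4)) (a, inp s, R) (a + 2, inp (?s n), R1)"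
      "represents R1 (?s n)" "agree_below d R R1" "R1 (treg d) = ?N - n"
      by auto
    have R2: "runs P (Suc 0) (a + 2, inp (?s n), R1) (a + 5, inp (?s n), R1)"
      using Repeat.prems Suc.prems R1(4) by auto
    obtain R3 where R3: "runs P (cost p (?s n)) (a + 5, inp (?s n), R1)
        (a + 5 + code_length p, inp (?s (Suc n)), R3)"
      "represents R3 (?s (Suc n))" "agree_below (Suc d) R1 R3"
      using Repeat.IH[of R1 "?s n" "a + 5" "Suc d"] Repeat.prems R1(2)
      by (auto simp: eval_nat_numeral)
    have R3d: "R3 (treg d) = ?N - n"
      using R1(4) R3(3) by (simp add: agree_below_def)
    let ?R = "R3(treg (Suc d) := 1, treg d := ?N - Suc n)"
    have "runs P (Suc (Suc (Suc 0))) (a + 5 + code_length p, inp (?s (Suc n)), R3)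
        (a + 2, inp (?s (Suc n)), ?R)"
      using Repeat.prems R3d by (simp add: eval_nat_numeral)
    from runs_trans[OF runs_trans[OF runs_trans[OF R1(1) R2] R3(1)] this]
    have "runs P (2 + (\<Sum>i<Suc n. cost p (?s i) + 4)) (a, inp s, R) (a + 2, inp (?s (Suc n)), ?R)"
      by (simp add: algebra_simps eval_nat_numeral)
    moreover have "represents ?R (?s (Suc n))" using R3(2) by simp
    moreover have "agree_below d R ?R"
      using agree_below_trans[OF R1(3) agree_below_mono[OF R3(3)]] by simp
    moreover have "?R (treg d) = ?N - Suc n" by simp
    ultimately show ?case by blast
  qed
  from loop[OF order_refl] obtain R1 where R1:
    "runs P (2 + (\<Sum>i<?N. cost p (?s i) + 4)) (a, inp s, R) (a + 2, inp (?s ?N), R1)"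
    "represents R1 (?s ?N)" "agree_below d R R1" "R1 (treg d) = 0"
    by auto
  let ?R = "R1(treg (Suc d) := 1)"
  have "runs P (Suc (Suc (Suc 0))) (a + 2, inp (?s ?N), R1)
      (a + code_length p + 8, inp (?s ?N), ?R)"
    using Repeat.prems R1(4) by (simp add: eval_nat_numeral)
  from runs_trans[OF R1(1) this]
  have "runs P (cost (Repeat x p) s) (a, inp s, R)
      (a + code_length (Repeat x p), inp (sem (Repeat x p) s), ?R)"
    by (simp add: add_ac eval_nat_numeral)
  moreover have "represents ?R (sem (Repeat x p) s)" using R1(2) by simp
  moreover have "agree_below d R ?R" using R1(3) by simp
  ultimately show ?case by blast
qed

definition init_env :: "nat list \<Rightarrow> env" where
  "init_env w = \<lparr>inp = w, var = (\<lambda>_. 0), arr = (\<lambda>_ _. 0)\<rparr>"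

text \<open>Cell 0 of array 0 is register 0, where the machine leaves its output.\<close>

theorem computes_in_code:
  assumes "prog_ok p" "cost p (init_env w) \<le> t"
  shows "computes_in (code p 0 0) w t (arr (sem p (init_env w)) 0 0)"
proof -
  let ?P = "code p 0 0" and ?s = "init_env w"
  have "represents (\<lambda>_. 0) ?s" by (simp add: represents_def init_env_def)
  moreover have "code_at ?P 0 ?P" by (simp add: code_at_def)
  ultimately obtain R where R:
    "runs ?P (cost p ?s) (0, inp ?s, \<lambda>_. 0) (0 + code_length p, inp (sem p ?s), R)"
    "represents R (sem p ?s)"
    using runs_code[OF assms(1)] by blast
  let ?c = "(code_length p, inp (sem p ?s), R)"
  \<comment> \<open>The final program counter equals the length of the program, so the run may be
    padded to any larger number of steps.\<close>
  have "runs ?P n ?c ?c" for n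
    by (induction n) (simp_all add: runs_def step_def)
  then have "runs ?P (cost p ?s + (t - cost p ?s)) (0, w, \<lambda>_. 0) ?c"
    using R(1) by (intro runs_trans) (auto simp: init_env_def)
  moreover have "R 0 = arr (sem p ?s) 0 0"
    using R(2) unfolding represents_def cell_def by (metis add_0 mult_0_right zero_less_numeral)
  ultimately show ?thesis
    using assms(2) unfolding computes_in_def runs_def
    by (intro exI[of _ "code_length p"] exI[of _ "inp (sem p ?s)"] exI[of _ R]) simp
qed


section \<open>Connected pairs\<close>

text \<open>Since \<open>u\<close> and \<open>v\<close> differ, reflexivity of the closure
  contributes nothing at deleted vertices or outside the graph, and no vertex set has to be
  mentioned.\<close>

definition linked :: "'a rel \<Rightarrow> 'a set \<Rightarrow> 'a rel" where
  "linked E D = {(u, v). u \<noteq> v \<and> (u, v) \<in> (Restr E (- D))\<^sup>*}"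

lemma linked_subset_trancl: "linked E D \<subseteq> (Restr E (- D))\<^sup>+"
  by (auto simp: linked_def rtrancl_eq_or_trancl)

lemma finite_linked: "finite E \<Longrightarrow> finite (linked E D)"
  by (rule finite_subset[OF linked_subset_trancl]) simp

text \<open>In a symmetric digraph the vertices reachable from \<open>u\<close> induce a strongly
  connected component, which is the witness for the harder direction.\<close>

lemma (in sym_digraph) connected_pairs_eq:
  "connected_pairs G = {(u, v). u \<noteq> v \<and> (u, v) \<in> (arcs_ends G)\<^sup>*}"
proof -
  have "(\<exists>K\<in>sccs. u \<in> verts K \<and> v \<in> verts K) \<longleftrightarrow> (u, v) \<in> (arcs_ends G)\<^sup>*" if "u \<noteq> v" for u v
  proof
    assume "\<exists>K\<in>sccs. u \<in> verts K \<and> v \<in> verts K"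
    then have "\<exists>S\<in>sccs_verts. u \<in> S \<and> v \<in> S" using in_sccs_vertsI_sccs by blast
    then have "u \<rightarrow>\<^sup>* v" by (auto simp: sccs_verts_def)
    then show "(u, v) \<in> (arcs_ends G)\<^sup>*" by (rule reachable_rtranclI)
  next
    assume "(u, v) \<in> (arcs_ends G)\<^sup>*"
    then have "u \<rightarrow>\<^sup>* v"
      using that by (auto simp: rtrancl_eq_or_trancl)
    then have "G \<restriction> {w. u \<rightarrow>\<^sup>* w} \<in> sccs" "u \<in> verts G"
      using induce_reachable_is_in_sccs reachable_in_verts by blast+
    then show "\<exists>K\<in>sccs. u \<in> verts K \<and> v \<in> verts K"
      using \<open>u \<rightarrow>\<^sup>* v\<close> by (intro bexI[of _ "G \<restriction> {w. u \<rightarrow>\<^sup>* w}"]) auto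
  qed
  then show ?thesis by (auto simp: connected_pairs_def)
qed

lemma connected_pairs_delete:
  assumes "pair_graph G"
  shows "connected_pairs (with_proj G \<restriction> (pverts G - C)) = linked (parcs G) C"
proof -
  interpret pair_graph G by fact
  let ?H = "with_proj G \<restriction> (pverts G - C)"
  have ends: "arcs_ends ?H = Restr (parcs G) (- C)"
    by (auto simp: arcs_ends_def arc_to_ends_def induce_subgraph_def
      dest: arc_fst_in_verts arc_snd_in_verts)
  interpret H: sym_digraph ?H
    by (rule induced_graph_imp_graph, rule induced_induce) simp
  show ?thesis
    by (simp add: H.connected_pairs_eq ends linked_def)
qed

lemma (in pair_graph) sym_parcs: "sym (parcs G)"
  using sym_arcs by (simp add: symmetric_def)

lemma (in pair_graph) irrefl_parcs: "irrefl (parcs G)"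
proof (rule irreflI)
  show "(a, a) \<notin> parcs G" for a using pair_no_loops[of "(a, a)"] by auto
qed

lemma (in pair_graph) parcs_subset: "parcs G \<subseteq> pverts G \<times> pverts G"
  by (auto dest: arc_fst_in_verts arc_snd_in_verts)


section \<open>Branching\<close>

text \<open>
  \<open>D\<close> and \<open>F\<close> are the vertices deleted and kept so far, and \<open>r < 3 ^ c\<close> encodes the next \<open>c\<close>
  branching decisions, most significant ternary digit first.
\<close>

fun branch :: "'a \<times> 'a \<Rightarrow> 'a set \<times> 'a set \<times> nat \<times> nat \<Rightarrow> 'a set \<times> 'a set \<times> nat \<times> nat" where
  "branch (u, v) (D, F, r, c) =
    (if u \<in> D \<or> v \<in> D \<or> u \<in> F \<and> v \<in> F then (D, F, r, c)
     else if 2 * 3 ^ (c - 1) \<le> r then (D, insert v (insert u F), r - 2 * 3 ^ (c - 1), c - 1)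
     else if 3 ^ (c - 1) \<le> r then (insert v D, F, r - 3 ^ (c - 1), c - 1)
     else (insert u D, F, r, c - 1))"

declare branch.simps [simp del]

text \<open>A fixed solution \<open>C\<close> guides the choices, and \<open>U\<close> contains the
  ends of all listed edges avoiding \<open>C\<close>. The quantity
  \<open>card (C - D) + card (U - F)\<close> drops with every digit consumed, so \<open>c\<close>
  digits never run out, while \<open>D\<close> stays inside \<open>C\<close> and \<open>F\<close>
  inside \<open>U\<close>.\<close>

lemma fold_branch_exists:
  assumes "finite C" "finite U" "U \<inter> C = {}" "D \<subseteq> C" "F \<subseteq> U"
    and "\<And>u v. (u, v) \<in> set es \<Longrightarrow> u \<notin> C \<Longrightarrow> v \<notin> C \<Longrightarrow> u \<in> U \<and> v \<in> U"
    and "card (C - D) + card (U - F) \<le> c"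
  shows "\<exists>r<3 ^ c. \<exists>D' F' r' c'. fold branch es (D, F, r, c) = (D', F', r', c') \<and>
    D \<subseteq> D' \<and> D' \<subseteq> C \<and> F \<subseteq> F' \<and> F' \<subseteq> U \<and>
    (\<forall>(u, v)\<in>set es. u \<in> D' \<or> v \<in> D' \<or> u \<in> F' \<and> v \<in> F')"
  using assms
proof (induction es arbitrary: D F c)
  case Nil
  then show ?case by (intro exI[of _ 0]) auto
next
  case (Cons e es)
  obtain u v where e: "e = (u, v)" by (cases e)
  define settled where "settled D' F' \<longleftrightarrow> D \<subseteq> D' \<and> D' \<subseteq> C \<and> F \<subseteq> F' \<and> F' \<subseteq> U \<and>
    (\<forall>(u, v)\<in>set (e # es). u \<in> D' \<or> v \<in> D' \<or> u \<in> F' \<and> v \<in> F')" for D' F'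
  \<comment> \<open>An edge settled by \<open>(D1, F1)\<close> remains settled because both sets
    only grow; the induction hypothesis takes care of the rest of the list.\<close>
  have continue: "\<exists>r<3 ^ c1. \<exists>D' F' r' c'. fold branch es (D1, F1, r, c1) = (D', F', r', c') \<and>
      settled D' F'"
    if "D \<subseteq> D1" "D1 \<subseteq> C" "F \<subseteq> F1" "F1 \<subseteq> U" "u \<in> D1 \<or> v \<in> D1 \<or> u \<in> F1 \<and> v \<in> F1"
      "card (C - D1) + card (U - F1) \<le> c1" for D1 F1 c1
  proof -
    have "\<exists>r<3 ^ c1. \<exists>D' F' r' c'. fold branch es (D1, F1, r, c1) = (D', F', r', c') \<and>
      D1 \<subseteq> D' \<and> D' \<subseteq> C \<and> F1 \<subseteq> F' \<and> F' \<subseteq> U \<and>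
      (\<forall>(u, v)\<in>set es. u \<in> D' \<or> v \<in> D' \<or> u \<in> F' \<and> v \<in> F')"
    proof (rule Cons.IH)
      show "a \<in> U \<and> b \<in> U" if "(a, b) \<in> set es" "a \<notin> C" "b \<notin> C" for a b
        using Cons.prems(6)[of a b] that by simp
    qed (use Cons.prems(1-5) that in auto)
    then obtain r D' F' r' c' where r: "r < 3 ^ c1"
        "fold branch es (D1, F1, r, c1) = (D', F', r', c')" and
      D': "D1 \<subseteq> D'" "D' \<subseteq> C" "F1 \<subseteq> F'" "F' \<subseteq> U"
        "\<forall>(u, v)\<in>set es. u \<in> D' \<or> v \<in> D' \<or> u \<in> F' \<and> v \<in> F'"
      by blast
    have "settled D' F'"
      unfolding settled_def using D' that(1,3,5) by (auto simp: e)
    with r show ?thesis by blast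
  qed
  show ?case
  proof (cases "u \<in> D \<or> v \<in> D \<or> u \<in> F \<and> v \<in> F")
    case True
    then show ?thesis
      using continue[of D F c] Cons.prems(4,5,7) by (simp add: e settled_def branch.simps)
  next
    case False
    define w where "w = (3::nat) ^ (c - 1)"
    have branch: "r < w \<Longrightarrow> branch (u, v) (D, F, r, c) = (insert u D, F, r, c - 1)"
      "r < w \<Longrightarrow> branch (u, v) (D, F, w + r, c) = (insert v D, F, r, c - 1)"
      "r < w \<Longrightarrow> branch (u, v) (D, F, 2 * w + r, c) = (D, insert v (insert u F), r, c - 1)" for r
      using False unfolding branch.simps w_def[symmetric] by auto
    have less: "card (C - insert y D) < card (C - D)" if "y \<in> C" "y \<notin> D" for y
      using that Cons.prems(1) by (intro psubset_card_mono) auto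
    \<comment> \<open>The leading digit is dictated by \<open>C\<close>: 0 if \<open>u\<close> lies
      in \<open>C\<close>, 1 if \<open>v\<close> does, 2 if neither does. The drop is strict because
      neither end is in \<open>D\<close> and not both are in \<open>F\<close>.\<close>
    have "\<exists>d D1 F1. d < 3 \<and> D \<subseteq> D1 \<and> D1 \<subseteq> C \<and> F \<subseteq> F1 \<and> F1 \<subseteq> U \<and>
      (u \<in> D1 \<or> v \<in> D1 \<or> u \<in> F1 \<and> v \<in> F1) \<and> card (C - D1) + card (U - F1) < c \<and>
      (\<forall>r<w. branch (u, v) (D, F, d * w + r, c) = (D1, F1, r, c - 1))"
    proof -
      consider "u \<in> C" | "v \<in> C" | "u \<notin> C" "v \<notin> C" by blast
      then show ?thesis
      proof cases
        case 1
        then have "card (C - insert u D) + card (U - F) < c"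
          using False less[of u] Cons.prems(7) by auto
        then show ?thesis
          using 1 Cons.prems(4,5) branch(1)
          by - (rule exI[of _ 0], rule exI[of _ "insert u D"], rule exI[of _ F], auto)
      next
        case 2
        then have "card (C - insert v D) + card (U - F) < c"
          using False less[of v] Cons.prems(7) by auto
        then show ?thesis
          using 2 Cons.prems(4,5) branch(2)
          by - (rule exI[of _ 1], rule exI[of _ "insert v D"], rule exI[of _ F], auto)
      next
        case 3
        then have uv: "u \<in> U" "v \<in> U" using Cons.prems(6) e by auto
        then have "card (U - insert v (insert u F)) < card (U - F)"
          using False Cons.prems(2) by (intro psubset_card_mono) auto
        then show ?thesis
          using uv Cons.prems(4,5,7) branch(3)
          by - (rule exI[of _ 2], rule exI[of _ D], rule exI[of _ "insert v (insert u F)"], auto)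
      qed
    qed
    then obtain d D1 F1 where d: "d < 3" "D \<subseteq> D1" "D1 \<subseteq> C" "F \<subseteq> F1" "F1 \<subseteq> U"
      "u \<in> D1 \<or> v \<in> D1 \<or> u \<in> F1 \<and> v \<in> F1" "card (C - D1) + card (U - F1) < c"
      "\<And>r. r < w \<Longrightarrow> branch (u, v) (D, F, d * w + r, c) = (D1, F1, r, c - 1)"
      by blast
    have "card (C - D1) + card (U - F1) \<le> c - 1" using d(7) by simp
    from continue[OF d(2-6) this] obtain r D' F' r' c' where r: "r < w"
      "fold branch es (D1, F1, r, c - 1) = (D', F', r', c')" "settled D' F'"
      unfolding w_def by blast
    \<comment> \<open>The strict drop forces \<open>c\<close> to be positive, so
      \<open>c - 1\<close> is not truncated here and \<open>w\<close> really is a third of the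
      range.\<close>
    have "3 ^ c = 3 * w"
      using d(7) unfolding w_def by (cases c) auto
    moreover have "d * w \<le> 2 * w" using d(1) by (intro mult_right_mono) auto
    ultimately have "d * w + r < 3 ^ c" using r(1) by linarith
    moreover have "fold branch (e # es) (D, F, d * w + r, c) = (D', F', r', c')"
      using d(8)[OF r(1)] r(2) by (simp add: e)
    ultimately show ?thesis using r(3) unfolding settled_def by blast
  qed
qed

text \<open>Needed for arbitrary strings, which need not follow any solution: whatever they delete
  is an end of an arc, hence a vertex of the graph and admissible in a cut.\<close>

lemma fold_branch_subset:
  "fold branch es (D, F, r, c) = (D', F', r', c') \<Longrightarrow> D' \<subseteq> D \<union> Field (set es)"
proof (induction es arbitrary: D F r c)
  case (Cons e es)
  obtain u v where e: "e = (u, v)" by (cases e)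
  obtain D1 F1 r1 c1 where b: "branch (u, v) (D, F, r, c) = (D1, F1, r1, c1)"
    by (metis prod_cases4)
  then have "D1 \<subseteq> insert v (insert u D)" by (auto simp: branch.simps split: if_splits)
  moreover have "D' \<subseteq> D1 \<union> Field (set es)"
    using Cons.prems by (intro Cons.IH[of D1 F1 r1 c1]) (simp add: e b)
  ultimately show ?case by (auto simp: e Field_def)
qed simp

text \<open>An arc avoiding \<open>D\<close> has both ends in \<open>F\<close>, hence outside
  \<open>C\<close>; so a path avoiding \<open>D\<close> also avoids \<open>C\<close>.\<close>

lemma linked_subset:
  assumes "\<And>u v. (u, v) \<in> E \<Longrightarrow> u \<in> D \<or> v \<in> D \<or> u \<in> F \<and> v \<in> F" "F \<inter> C = {}"
  shows "linked E D \<subseteq> linked E C"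
proof -
  have "Restr E (- D) \<subseteq> Restr E (- C)" using assms by fast
  then show ?thesis unfolding linked_def using rtrancl_mono by blast
qed

theorem branch_complete:
  assumes E: "set es = E" "sym E" "irrefl E"
    and C: "finite C" "card C \<le> k" "card (linked E C) \<le> x"
  shows "\<exists>r<3 ^ (k + x). \<exists>D F r' c'. fold branch es ({}, {}, r, k + x) = (D, F, r', c') \<and>
    card D \<le> k \<and> card (linked E D) \<le> x"
proof -
  have "finite E" using E(1) by auto
  let ?U = "{u. u \<notin> C \<and> (\<exists>v. v \<notin> C \<and> (u, v) \<in> E)}"
  have "?U \<subseteq> fst ` linked E C"
  proof
    fix u assume "u \<in> ?U"
    then obtain v where "u \<notin> C" "v \<notin> C" "(u, v) \<in> E" by blast
    \<comment> \<open>Irreflexivity ensures that the edge joins two distinct vertices and so counts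
      as a connected pair.\<close>
    then have "(u, v) \<in> linked E C"
      using E(3) by (auto simp: linked_def irrefl_def)
    then show "u \<in> fst ` linked E C" by force
  qed
  then have U: "finite ?U" "card ?U \<le> x"
    using C(3) finite_linked[OF \<open>finite E\<close>, of C] surj_card_le[of "linked E C" ?U fst]
      finite_subset[of ?U "fst ` linked E C"]
    by auto
  have "\<exists>r<3 ^ (k + x). \<exists>D F r' c'. fold branch es ({}, {}, r, k + x) = (D, F, r', c') \<and>
    {} \<subseteq> D \<and> D \<subseteq> C \<and> {} \<subseteq> F \<and> F \<subseteq> ?U \<and>
    (\<forall>(u, v)\<in>set es. u \<in> D \<or> v \<in> D \<or> u \<in> F \<and> v \<in> F)"
    \<comment> \<open>The initial potential is \<open>card C + card ?U\<close>. By symmetry the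
      second end of an edge outside \<open>C\<close> also has a neighbour outside \<open>C\<close>,
      so both ends lie in \<open>?U\<close>.\<close>
    by (rule fold_branch_exists) (use U C E(1) symD[OF E(2)] in auto)
  then obtain r D F r' c' where r: "r < 3 ^ (k + x)"
      "fold branch es ({}, {}, r, k + x) = (D, F, r', c')" and
    D: "D \<subseteq> C" "F \<subseteq> ?U" "\<forall>(u, v)\<in>set es. u \<in> D \<or> v \<in> D \<or> u \<in> F \<and> v \<in> F"
    by blast
  have "linked E D \<subseteq> linked E C"
    using D E(1) by (intro linked_subset[where F = F]) auto
  then have "card (linked E D) \<le> x"
    using C(3) card_mono[OF finite_linked[OF \<open>finite E\<close>]] le_trans by blast
  moreover have "card D \<le> k" using card_mono[OF C(1) D(1)] C(2) by simp
  ultimately show ?thesis using r by blast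
qed


section \<open>Component labels\<close>

text \<open>Propagation of minimal labels along one arc, in the manner of Bellman-Ford. A symmetric
  edge set lists both orientations, so labels travel both ways.\<close>

fun relax :: "'a set \<Rightarrow> 'a \<times> 'a \<Rightarrow> ('a \<Rightarrow> nat) \<Rightarrow> 'a \<Rightarrow> nat" where
  "relax D (u, v) l = (if u \<notin> D \<and> v \<notin> D \<and> l u < l v then l(v := l u) else l)"

lemma fold_relax_le: "fold (relax D) es l w \<le> l w"
proof (induction es arbitrary: l)
  case (Cons e es)
  have "relax D e l w \<le> l w" by (cases e) auto
  then show ?case using Cons[of "relax D e l"] by simp
qed simp

text \<open>The label of \<open>u\<close> may have dropped before the arc is reached, and that of
  \<open>v\<close> may drop afterwards; both only help against the label that \<open>u\<close> had
  at the start of the pass.\<close>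

lemma fold_relax_edge:
  assumes "(u, v) \<in> set es" "u \<notin> D" "v \<notin> D"
  shows "fold (relax D) es l v \<le> l u"
  using assms(1)
proof (induction es arbitrary: l)
  case (Cons e es)
  show ?case
  proof (cases "(u, v) \<in> set es")
    case True
    have "relax D e l u \<le> l u" by (cases e) auto
    then show ?thesis using Cons.IH[OF True, of "relax D e l"] by simp
  next
    case False
    then have "relax D e l v \<le> l u" using Cons.prems assms by auto
    then show ?thesis using fold_relax_le[of D es "relax D e l" v] by simp
  qed
qed simp

lemma fold_relax_sound:
  assumes "\<And>v. (l v, v) \<in> (Restr E (- D))\<^sup>*" "set es \<subseteq> E"
  shows "(fold (relax D) es l v, v) \<in> (Restr E (- D))\<^sup>*"
  using assms
proof (induction es arbitrary: l)
  case (Cons e es)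
  obtain u v where e: "e = (u, v)" by (cases e)
  have "(relax D e l w, w) \<in> (Restr E (- D))\<^sup>*" for w
  proof (cases "u \<notin> D \<and> v \<notin> D \<and> l u < l v \<and> w = v")
    case True
    then have "(u, w) \<in> Restr E (- D)" using Cons.prems(2) e by simp
    then have "(l u, w) \<in> (Restr E (- D))\<^sup>*" by (rule rtrancl_into_rtrancl[OF Cons.prems(1)])
    then show ?thesis using True by (simp add: e)
  next
    case False
    then have "relax D e l w = l w" by (auto simp: e)
    then show ?thesis using Cons.prems(1)[of w] by simp
  qed
  from Cons.IH[OF this] show ?case using Cons.prems(2) by simp
qed simp

text \<open>The final label of a vertex is the least index in its component: it is an index from
  that component, and after \<open>i\<close> rounds it is at most every index within
  \<open>i\<close> arcs.\<close>

theorem relax_labels: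
  fixes E :: "nat rel" and D :: "nat set"
  assumes E: "set es = E" "sym E" and m: "card E \<le> m"
  defines "l \<equiv> (fold (relax D) es ^^ m) (\<lambda>v. v)"
  shows "l u = l v \<longleftrightarrow> (u, v) \<in> (Restr E (- D))\<^sup>*"
proof -
  let ?R = "Restr E (- D)"
  have sound: "((fold (relax D) es ^^ i) (\<lambda>v. v) v, v) \<in> ?R\<^sup>*" for i v
  proof (induction i arbitrary: v)
    case (Suc i)
    then show ?case
      using fold_relax_sound[of "(fold (relax D) es ^^ i) (\<lambda>v. v)" E D es v] E(1) by simp
  qed simp
  have step: "(w, v) \<in> ?R ^^ j \<Longrightarrow> j \<le> i \<Longrightarrow> (fold (relax D) es ^^ i) (\<lambda>v. v) v \<le> w" for i j w v
  proof (induction i arbitrary: j v)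
    case 0
    have "j = 0" using 0(2) by simp
    then show ?case using 0(1) unfolding \<open>j = 0\<close> by simp
  next
    case (Suc i)
    show ?case
    proof (cases "j \<le> i")
      case True
      have "(fold (relax D) es ^^ Suc i) (\<lambda>v. v) v \<le> (fold (relax D) es ^^ i) (\<lambda>v. v) v"
        using fold_relax_le[of D es "(fold (relax D) es ^^ i) (\<lambda>v. v)" v] by simp
      also have "\<dots> \<le> w" by (rule Suc.IH[OF Suc.prems(1) True])
      finally show ?thesis .
    next
      case False
      then obtain y where y: "(w, y) \<in> ?R ^^ i" "(y, v) \<in> ?R"
        using Suc.prems by (metis le_SucE relpow_Suc_E)
      have "(fold (relax D) es ^^ Suc i) (\<lambda>v. v) v \<le> (fold (relax D) es ^^ i) (\<lambda>v. v) y"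
        using fold_relax_edge[of y v es D "(fold (relax D) es ^^ i) (\<lambda>v. v)"] E(1) y(2) by simp
      also have "\<dots> \<le> w" by (rule Suc.IH[OF y(1) order_refl])
      finally show ?thesis .
    qed
  qed
  have le: "l v \<le> w" if wv: "(w, v) \<in> ?R\<^sup>*" for w v
  proof -
    have "finite E" using E(1) by auto
    then have "finite ?R" "card ?R \<le> m" using m card_mono[of E ?R] by auto
    \<comment> \<open>A walk between connected vertices can be taken with at most as many arcs as
      the relation has, so \<open>m\<close> rounds suffice.\<close>
    then obtain j where "j \<le> card ?R" "(w, v) \<in> ?R ^^ j"
      using wv unfolding rtrancl_finite_eq_relpow[OF \<open>finite ?R\<close>] by blast
    then have "j \<le> m" using \<open>card ?R \<le> m\<close> by linarith
    with \<open>(w, v) \<in> ?R ^^ j\<close> show ?thesis unfolding l_def by (rule step)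
  qed
  have label: "(l v, v) \<in> ?R\<^sup>*" for v
    unfolding l_def by (rule sound)
  have "sym ?R" using E(2) by (auto simp: sym_def)
  then have "sym (?R\<^sup>*)" by (rule sym_rtrancl)
  show ?thesis
  proof
    assume "l u = l v"
    then have "(u, l v) \<in> ?R\<^sup>*" using symD[OF \<open>sym (?R\<^sup>*)\<close> label[of u]] by simp
    then show "(u, v) \<in> ?R\<^sup>*" using label by (rule rtrancl_trans)
  next
    assume uv: "(u, v) \<in> ?R\<^sup>*"
    have "l v \<le> l u" by (rule le[OF rtrancl_trans[OF label uv]])
    moreover have "l u \<le> l v"
      by (rule le[OF rtrancl_trans[OF label symD[OF \<open>sym (?R\<^sup>*)\<close> uv]]])
    ultimately show "l u = l v" by simp
  qed
qed


section \<open>The search program\<close>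

text \<open>
  Besides the input \<open>n\<close>, \<open>k\<close>, \<open>x\<close> the variables hold \<open>l = k + x\<close>, \<open>p = 3 ^ l\<close>, the number \<open>m\<close> of arcs,
  the current arc \<open>(u, v)\<close>, the number \<open>t < p\<close> encoding the decisions being tried, its undecoded
  remainder \<open>r\<close> with \<open>c\<close> digits left, the number \<open>d\<close> of deleted vertices, the number \<open>q\<close> of
  connected pairs, and the answer \<open>y\<close>; the others are scratch.
\<close>

abbreviation (input) "nV \<equiv> 0 :: nat"
abbreviation (input) "kV \<equiv> 1 :: nat"
abbreviation (input) "xV \<equiv> 2 :: nat"
abbreviation (input) "lV \<equiv> 3 :: nat"
abbreviation (input) "pV \<equiv> 4 :: nat"
abbreviation (input) "mV \<equiv> 5 :: nat"
abbreviation (input) "uV \<equiv> 6 :: nat"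
abbreviation (input) "vV \<equiv> 7 :: nat"
abbreviation (input) "tV \<equiv> 8 :: nat"
abbreviation (input) "rV \<equiv> 9 :: nat"
abbreviation (input) "cV \<equiv> 10 :: nat"
abbreviation (input) "eV \<equiv> 11 :: nat"
abbreviation (input) "wV \<equiv> 12 :: nat"
abbreviation (input) "aV \<equiv> 13 :: nat"
abbreviation (input) "bV \<equiv> 14 :: nat"
abbreviation (input) "dV \<equiv> 15 :: nat"
abbreviation (input) "qV \<equiv> 16 :: nat"
abbreviation (input) "yV \<equiv> 17 :: nat"
abbreviation (input) "iV \<equiv> 18 :: nat"

abbreviation (input) "powA \<equiv> 0 :: nat"
abbreviation (input) "srcA \<equiv> 1 :: nat"
abbreviation (input) "tgtA \<equiv> 2 :: nat"
abbreviation (input) "delA \<equiv> 3 :: nat"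
abbreviation (input) "keepA \<equiv> 4 :: nat"
abbreviation (input) "labA \<equiv> 5 :: nat"

definition For :: "nat \<Rightarrow> nat \<Rightarrow> prog \<Rightarrow> prog" where
  "For i n p = Assign i (Num 0) ;; Repeat n (p ;; Assign i (Plus (Var i) (Num 1)))"

definition read_params :: prog where
  "read_params =
    Input nV ;; Input kV ;; Input xV ;;
    Assign lV (Plus (Var kV) (Var xV)) ;;
    Assign pV (Num 1) ;; Update powA (Num 0) (Num 1)"

text \<open>Decoding descends from \<open>3 ^ c\<close> to \<open>3 ^ (c - 1)\<close>, which would
  need a division; hence the table. As a by-product \<open>pV\<close> ends as the number of
  strings.\<close>

definition powers :: prog where
  "powers =
    For iV lV (
      Assign pV (Plus (Var pV) (Plus (Var pV) (Var pV))) ;;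
      Update powA (Plus (Var iV) (Num 1)) (Var pV))"

definition read_edges :: prog where
  "read_edges =
    Assign mV (Num 0) ;;
    For uV nV (
      For vV nV (
        Input bV ;;
        When (Var bV) (
          Update srcA (Var mV) (Var uV) ;; Update tgtA (Var mV) (Var vV) ;;
          Assign mV (Plus (Var mV) (Num 1)))))"

definition reset :: prog where
  "reset =
    For vV nV (
      Update delA (Var vV) (Num 0) ;; Update keepA (Var vV) (Num 0) ;;
      Update labA (Var vV) (Var vV))"

definition load_edge :: prog where
  "load_edge = Assign uV (Arr srcA (Var eV)) ;; Assign vV (Arr tgtA (Var eV))"

text \<open>Tests ask whether a number is positive, so Boolean conditions are phrased with truncated
  subtraction: on 0/1 marks this difference is positive iff both are 0. \<open>differ\<close> and
  \<open>decide\<close> use the same device.\<close>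

definition if_undeleted :: "prog \<Rightarrow> prog" where
  "if_undeleted = When (Minus (Num 1) (Plus (Arr delA (Var uV)) (Arr delA (Var vV))))"

text \<open>\<open>aV\<close> is positive iff \<open>w \<le> r\<close>, and \<open>bV\<close> iff
  \<open>2 * w \<le> r\<close>. Both are computed before \<open>rV\<close> changes. The last test is
  on \<open>aV\<close> alone, since a positive \<open>bV\<close> implies a positive
  \<open>aV\<close>.\<close>

definition branch_prog :: prog where
  "branch_prog =
    load_edge ;;
    if_undeleted (
      When (Minus (Num 2) (Plus (Arr keepA (Var uV)) (Arr keepA (Var vV)))) (
        Assign cV (Minus (Var cV) (Num 1)) ;;
        Assign wV (Arr powA (Var cV)) ;;
        Assign aV (Minus (Plus (Num 1) (Var rV)) (Var wV)) ;;
        Assign bV (Minus (Plus (Num 1) (Var rV)) (Plus (Var wV) (Var wV))) ;;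
        When (Var bV) (
          Assign rV (Minus (Var rV) (Plus (Var wV) (Var wV))) ;;
          Update keepA (Var uV) (Num 1) ;; Update keepA (Var vV) (Num 1)) ;;
        When (Minus (Num 1) (Var bV)) (
          When (Var aV) (
            Assign rV (Minus (Var rV) (Var wV)) ;; Update delA (Var vV) (Num 1))) ;;
        When (Minus (Num 1) (Var aV)) (Update delA (Var uV) (Num 1))))"

definition branch_all :: prog where
  "branch_all = Assign rV (Var tV) ;; Assign cV (Var lV) ;; For eV mV branch_prog"

definition relax_prog :: prog where
  "relax_prog =
    load_edge ;;
    if_undeleted (
      When (Minus (Arr labA (Var vV)) (Arr labA (Var uV))) (
        Update labA (Var vV) (Arr labA (Var uV))))"

definition relax_all :: prog where
  "relax_all = For iV mV (For eV mV relax_prog)"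

definition count_deleted :: prog where
  "count_deleted =
    Assign dV (Num 0) ;; For vV nV (Assign dV (Plus (Var dV) (Arr delA (Var vV))))"

definition differ :: "expr \<Rightarrow> expr \<Rightarrow> expr" where
  "differ a b = Plus (Minus a b) (Minus b a)"

text \<open>Deleted vertices need no separate treatment: each keeps its own index as label, and no
  other vertex ever acquires it.\<close>

definition count_pairs :: prog where
  "count_pairs =
    Assign qV (Num 0) ;;
    For uV nV (
      For vV nV (
        When (differ (Var uV) (Var vV)) (
          When (Minus (Num 1) (differ (Arr labA (Var uV)) (Arr labA (Var vV)))) (
            Assign qV (Plus (Var qV) (Num 1))))))"

definition decide :: prog where
  "decide =
    When (Minus (Num 1) (Plus (Minus (Var dV) (Var kV)) (Minus (Var qV) (Var xV)))) (
      Assign yV (Num 1))"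

definition try_string :: prog where
  "try_string = reset ;; branch_all ;; relax_all ;; count_deleted ;; count_pairs ;; decide"

definition search :: prog where
  "search = Assign yV (Num 0) ;; For tV pV try_string"

text \<open>The answer overwrites the entry \<open>3 ^ 0\<close> of the power table, which is safe
  once the search is over.\<close>

definition cnc_prog :: prog where
  "cnc_prog = read_params ;; powers ;; read_edges ;; search ;; Update 0 (Num 0) (Var yV)"

lemmas prog_defs = cnc_prog_def search_def try_string_def decide_def count_pairs_def differ_def
  count_deleted_def relax_all_def relax_prog_def branch_all_def branch_prog_def if_undeleted_def
  load_edge_def reset_def read_edges_def powers_def read_params_def For_def


section \<open>Correctness of the search program\<close>

lemma funpow_invariant:
  assumes "I 0 s" "\<And>j s. j < n \<Longrightarrow> I j s \<Longrightarrow> I (Suc j) (f s)"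
  shows "I n ((f ^^ n) s)"
proof -
  have "j \<le> n \<Longrightarrow> I j ((f ^^ j) s)" for j
    by (induction j) (use assms in auto)
  then show ?thesis by simp
qed

text \<open>The rule tracks the index itself, so \<open>I\<close> need not mention it. The number of
  rounds is the value of \<open>n\<close> on entry, and \<open>I (Suc j)\<close> is required after
  the increment.\<close>

lemma For_invariant:
  assumes "i \<notin> assigned p" "i \<noteq> n"
    and "I 0 (s\<lparr>var := (var s)(i := 0)\<rparr>)"
    and "\<And>j s'. j < var s n \<Longrightarrow> var s' i = j \<Longrightarrow> I j s' \<Longrightarrow>
      I (Suc j) ((sem p s')\<lparr>var := (var (sem p s'))(i := Suc j)\<rparr>)"
  shows "I (var s n) (sem (For i n p) s)"
proof -
  let ?f = "sem (p ;; Assign i (Plus (Var i) (Num 1)))"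
  let ?s = "s\<lparr>var := (var s)(i := 0)\<rparr>"
  have "var ((?f ^^ var s n) ?s) i = var s n \<and> I (var s n) ((?f ^^ var s n) ?s)"
    by (rule funpow_invariant) (use assms var_sem_unassigned[OF assms(1)] in auto)
  then show ?thesis using assms(2) by (simp add: For_def)
qed

lemma assigned_For [simp]: "assigned (For i n p) = insert i (assigned p)"
  by (auto simp: For_def)

lemma updated_For [simp]: "updated (For i n p) = updated p"
  by (simp add: For_def)

text \<open>The data that the search only reads. It occupies the variables below 6 and the arrays
  below 3, so its preservation becomes a syntactic check.\<close>

definition loaded :: "nat \<Rightarrow> nat \<Rightarrow> nat \<Rightarrow> (nat \<times> nat) list \<Rightarrow> env \<Rightarrow> bool" where
  "loaded n k x es s \<longleftrightarrow>
    var s nV = n \<and> var s kV = k \<and> var s xV = x \<and> var s lV = k + x \<and> var s pV = 3 ^ (k + x) \<and>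
    var s mV = length es \<and> (\<forall>i\<le>k + x. arr s powA i = 3 ^ i) \<and>
    (\<forall>i<length es. arr s srcA i = fst (es ! i) \<and> arr s tgtA i = snd (es ! i))"

lemma loaded_sem:
  assumes "loaded n k x es s" "assigned p \<inter> {..<6} = {}" "updated p \<inter> {..<3} = {}"
  shows "loaded n k x es (sem p s)"
proof -
  have "var (sem p s) i = var s i" if "i < 6" for i
    using that assms(2) by (intro var_sem_unassigned) auto
  moreover have "arr (sem p s) j = arr s j" if "j < 3" for j
    using that assms(3) by (intro arr_sem_unupdated) auto
  ultimately show ?thesis using assms(1) by (simp add: loaded_def)
qed

lemma loaded_var_update:
  "loaded n k x es s \<Longrightarrow> 6 \<le> i \<Longrightarrow> loaded n k x es (s\<lparr>var := (var s)(i := a)\<rparr>)"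
  by (simp add: loaded_def)

text \<open>With \<open>S\<close> confined to indices below \<open>n\<close>, the first
  \<open>n\<close> cells determine it, and adding them up gives exactly
  \<open>card S\<close>.\<close>

definition holds_set :: "nat \<Rightarrow> nat \<Rightarrow> nat set \<Rightarrow> env \<Rightarrow> bool" where
  "holds_set n j S s \<longleftrightarrow> S \<subseteq> {..<n} \<and> (\<forall>v<n. arr s j v = of_bool (v \<in> S))"

section \<open>The passes made for a single decision string\<close>

lemma sem_reset:
  assumes "loaded n k x es s"
  shows "holds_set n delA {} (sem reset s)" "holds_set n keepA {} (sem reset s)"
    "\<forall>v<n. arr (sem reset s) labA v = v"
proof -
  let ?I = "\<lambda>j s. holds_set j delA {} s \<and> holds_set j keepA {} s \<and> (\<forall>v<j. arr s labA v = v)"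
  have "?I (var s nV) (sem reset s)"
    unfolding reset_def
    by (rule For_invariant) (auto simp: holds_set_def less_Suc_eq)
  then show "holds_set n delA {} (sem reset s)" "holds_set n keepA {} (sem reset s)"
    "\<forall>v<n. arr (sem reset s) labA v = v"
    using assms by (auto simp: loaded_def)
qed

lemma sem_load_edge:
  assumes "loaded n k x es s" "var s eV < length es"
  shows "sem load_edge s =
    s\<lparr>var := (var s)(uV := fst (es ! var s eV), vV := snd (es ! var s eV))\<rparr>"
  using assms by (simp add: load_edge_def loaded_def)

lemma sem_branch_prog:
  assumes "loaded n k x es s" "var s eV < length es" "set es \<subseteq> {..<n} \<times> {..<n}"
    and "holds_set n delA D s" "holds_set n keepA F s" "var s cV \<le> k + x"
    and "branch (es ! var s eV) (D, F, var s rV, var s cV) = (D', F', r', c')"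
  shows "holds_set n delA D' (sem branch_prog s)" "holds_set n keepA F' (sem branch_prog s)"
    "var (sem branch_prog s) rV = r'" "var (sem branch_prog s) cV = c'" "c' \<le> k + x"
proof -
  obtain u v where uv: "es ! var s eV = (u, v)" by fastforce
  then have less: "u < n" "v < n" using assms(2,3) nth_mem by fastforce+
  let ?c = "var s cV - Suc 0" and ?r = "var s rV"
  \<comment> \<open>If the digits are exhausted, \<open>?c\<close> is 0 by truncation and the table
    yields 1. The function \<open>branch\<close> truncates in the same way, so the two agree on such
    strings too.\<close>
  have pow: "arr s powA ?c = 3 ^ ?c"
    using assms(1,6) by (simp add: loaded_def)
  have vals: "arr s delA u = of_bool (u \<in> D)" "arr s delA v = of_bool (v \<in> D)"
    "arr s keepA u = of_bool (u \<in> F)" "arr s keepA v = of_bool (v \<in> F)"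
    using assms(4,5) less by (auto simp: holds_set_def)
  note sets = assms(4,5)[unfolded holds_set_def]
  let ?s = "sem branch_prog s"
  have "holds_set n delA D' ?s \<and> holds_set n keepA F' ?s \<and>
    var ?s rV = r' \<and> var ?s cV = c' \<and> c' \<le> k + x"
  proof (cases "u \<in> D \<or> v \<in> D \<or> u \<in> F \<and> v \<in> F")
    case True
    then have "arr ?s = arr s \<and> var ?s rV = ?r \<and> var ?s cV = var s cV"
      by (auto simp: branch_prog_def sem_load_edge[OF assms(1,2)] uv if_undeleted_def vals)
    then show ?thesis using True sets assms(6,7) by (auto simp: holds_set_def uv branch.simps)
  next
    case False
    then have undecided: "u \<notin> D" "v \<notin> D" "u \<in> F \<Longrightarrow> v \<notin> F" by auto
    then have *: "0 < 2 - ((of_bool (u \<in> F) :: nat) + of_bool (v \<in> F))" by auto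
    let ?b = "\<lambda>j A. \<forall>w. arr ?s j w = (if w \<in> A then 1 else arr s j w)"
    consider "2 * 3 ^ ?c \<le> ?r" | "3 ^ ?c \<le> ?r" "?r < 2 * 3 ^ ?c" | "?r < 3 ^ ?c" by linarith
    then show ?thesis
    proof cases
      case 1
      then have "?b delA {} \<and> ?b keepA {u, v} \<and> var ?s rV = ?r - 2 * 3 ^ ?c \<and> var ?s cV = ?c"
        using undecided(1,2) * by (simp add: branch_prog_def sem_load_edge[OF assms(1,2)] uv if_undeleted_def vals pow)
      then show ?thesis using 1 False sets less assms(6,7) by (auto simp: holds_set_def uv branch.simps)
    next
      case 2
      then have "?b delA {v} \<and> ?b keepA {} \<and> var ?s rV = ?r - 3 ^ ?c \<and> var ?s cV = ?c"
        using undecided(1,2) * by (simp add: branch_prog_def sem_load_edge[OF assms(1,2)] uv if_undeleted_def vals pow)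
      then show ?thesis using 2 False sets less assms(6,7) by (auto simp: holds_set_def uv branch.simps)
    next
      case 3
      then have "?b delA {u} \<and> ?b keepA {} \<and> var ?s rV = ?r \<and> var ?s cV = ?c"
        using undecided(1,2) * by (simp add: branch_prog_def sem_load_edge[OF assms(1,2)] uv if_undeleted_def vals pow)
      then show ?thesis using 3 False sets less assms(6,7) by (auto simp: holds_set_def uv branch.simps)
    qed
  qed
  then show "holds_set n delA D' ?s" "holds_set n keepA F' ?s"
    "var ?s rV = r'" "var ?s cV = c'" "c' \<le> k + x"
    by auto
qed

lemma sem_relax_prog:
  assumes "loaded n k x es s" "var s eV < length es" "set es \<subseteq> {..<n} \<times> {..<n}"
    and "holds_set n delA D s" "\<forall>v<n. arr s labA v = l v"
  shows "\<forall>v<n. arr (sem relax_prog s) labA v = relax D (es ! var s eV) l v"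
proof -
  obtain u v where uv: "es ! var s eV = (u, v)" by fastforce
  then have "u < n" "v < n" using assms(2,3) nth_mem by fastforce+
  then show ?thesis
    using assms(4,5)
    by (auto simp: relax_prog_def sem_load_edge[OF assms(1,2)] uv if_undeleted_def holds_set_def)
qed


lemma sem_branch_all:
  assumes "loaded n k x es s" "set es \<subseteq> {..<n} \<times> {..<n}"
    and "holds_set n delA {} s" "holds_set n keepA {} s"
    and "fold branch es ({}, {}, var s tV, k + x) = (D, F, r', c')"
  shows "holds_set n delA D (sem branch_all s)"
proof -
  define s0 where "s0 = s\<lparr>var := (var s)(rV := var s tV, cV := k + x)\<rparr>"
  have s0: "loaded n k x es s0" using assms(1) by (simp add: loaded_def s0_def)
  \<comment> \<open>The bound on \<open>cV\<close> keeps table lookups in range; \<open>rV\<close>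
    and \<open>cV\<close> are tied to the state of the fold over the arcs processed so far.\<close>
  define I where "I j s' \<longleftrightarrow> loaded n k x es s' \<and> var s' cV \<le> k + x \<and>
    (\<exists>D F. holds_set n delA D s' \<and> holds_set n keepA F s' \<and>
      fold branch (take j es) ({}, {}, var s tV, k + x) = (D, F, var s' rV, var s' cV))" for j and s' :: env
  have "I (var s0 mV) (sem (For eV mV branch_prog) s0)"
  proof (rule For_invariant)
    show "eV \<notin> assigned branch_prog" by (simp add: prog_defs)
    show "I 0 (s0\<lparr>var := (var s0)(eV := 0)\<rparr>)"
      using s0 assms(3,4) unfolding I_def
      by (auto intro!: loaded_var_update) (auto simp: s0_def holds_set_def)
  next
    fix j s1
    assume j: "j < var s0 mV" "var s1 eV = j" "I j s1"
    then obtain D F where DF: "holds_set n delA D s1" "holds_set n keepA F s1"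
      "fold branch (take j es) ({}, {}, var s tV, k + x) = (D, F, var s1 rV, var s1 cV)"
      unfolding I_def by blast
    have less: "j < length es" using j(1) s0 by (simp add: loaded_def)
    have s1: "loaded n k x es s1" "var s1 cV \<le> k + x" using j(3) by (auto simp: I_def)
    obtain D' F' r' c' where step: "branch (es ! j) (D, F, var s1 rV, var s1 cV) = (D', F', r', c')"
      by (metis prod_cases4)
    have e: "var s1 eV < length es" "branch (es ! var s1 eV) (D, F, var s1 rV, var s1 cV) = (D', F', r', c')"
      using less step j(2) by auto
    note post = sem_branch_prog[OF s1(1) e(1) assms(2) DF(1,2) s1(2) e(2)]
    have "loaded n k x es (sem branch_prog s1)"
      by (rule loaded_sem[OF s1(1)]) (auto simp: prog_defs)
    moreover have "fold branch (take (Suc j) es) ({}, {}, var s tV, k + x) = (D', F', r', c')"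
      using less DF(3) step by (simp add: take_Suc_conv_app_nth)
    ultimately show "I (Suc j) (sem branch_prog s1\<lparr>var := (var (sem branch_prog s1))(eV := Suc j)\<rparr>)"
      using post unfolding I_def by (auto intro!: loaded_var_update simp: holds_set_def)
  qed simp
  moreover have "sem branch_all s = sem (For eV mV branch_prog) s0"
    using assms(1) by (simp add: branch_all_def s0_def loaded_def)
  moreover have "var s0 mV = length es" using s0 by (simp add: loaded_def)
  ultimately show ?thesis using assms(5) by (auto simp: I_def)
qed

lemma sem_relax_round:
  assumes "loaded n k x es s" "set es \<subseteq> {..<n} \<times> {..<n}"
    and "holds_set n delA D s" "\<forall>v<n. arr s labA v = l v"
  shows "\<forall>v<n. arr (sem (For eV mV relax_prog) s) labA v = fold (relax D) es l v"
proof -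
  define I where "I j s' \<longleftrightarrow> loaded n k x es s' \<and> holds_set n delA D s' \<and>
    (\<forall>v<n. arr s' labA v = fold (relax D) (take j es) l v)" for j and s' :: env
  have "I (var s mV) (sem (For eV mV relax_prog) s)"
  proof (rule For_invariant)
    show "eV \<notin> assigned relax_prog" by (simp add: prog_defs)
    show "I 0 (s\<lparr>var := (var s)(eV := 0)\<rparr>)"
      using assms unfolding I_def by (auto intro!: loaded_var_update simp: holds_set_def)
  next
    fix j s1
    assume j: "j < var s mV" "var s1 eV = j" "I j s1"
    have less: "j < length es" using j(1) assms(1) by (simp add: loaded_def)
    have s1: "loaded n k x es s1" "holds_set n delA D s1"
      "\<forall>v<n. arr s1 labA v = fold (relax D) (take j es) l v"
      using j(3) by (auto simp: I_def)
    have "\<forall>v<n. arr (sem relax_prog s1) labA v = fold (relax D) (take (Suc j) es) l v"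
      using sem_relax_prog[OF s1(1) _ assms(2) s1(2,3)] less j(2)
      by (simp add: take_Suc_conv_app_nth)
    moreover have "loaded n k x es (sem relax_prog s1)"
      by (rule loaded_sem[OF s1(1)]) (auto simp: prog_defs)
    moreover have "arr (sem relax_prog s1) delA = arr s1 delA"
      by (rule arr_sem_unupdated) (simp add: prog_defs)
    ultimately show "I (Suc j) (sem relax_prog s1\<lparr>var := (var (sem relax_prog s1))(eV := Suc j)\<rparr>)"
      using s1(2) unfolding I_def by (auto intro!: loaded_var_update simp: holds_set_def)
  qed simp
  then show ?thesis using assms(1) by (simp add: I_def loaded_def)
qed

lemma sem_relax_all:
  assumes "loaded n k x es s" "set es \<subseteq> {..<n} \<times> {..<n}"
    and "holds_set n delA D s" "\<forall>v<n. arr s labA v = v"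
  shows "\<forall>v<n. arr (sem relax_all s) labA v = (fold (relax D) es ^^ length es) (\<lambda>v. v) v"
proof -
  define I where "I j s' \<longleftrightarrow> loaded n k x es s' \<and> holds_set n delA D s' \<and>
    (\<forall>v<n. arr s' labA v = (fold (relax D) es ^^ j) (\<lambda>v. v) v)" for j and s' :: env
  let ?p = "For eV mV relax_prog"
  have "I (var s mV) (sem (For iV mV ?p) s)"
  proof (rule For_invariant)
    show "iV \<notin> assigned ?p" by (simp add: prog_defs)
    show "I 0 (s\<lparr>var := (var s)(iV := 0)\<rparr>)"
      using assms unfolding I_def by (auto intro!: loaded_var_update simp: holds_set_def)
  next
    fix j s1
    assume j: "j < var s mV" "var s1 iV = j" "I j s1"
    have s1: "loaded n k x es s1" "holds_set n delA D s1"
      "\<forall>v<n. arr s1 labA v = (fold (relax D) es ^^ j) (\<lambda>v. v) v"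
      using j(3) by (auto simp: I_def)
    have "\<forall>v<n. arr (sem ?p s1) labA v = (fold (relax D) es ^^ Suc j) (\<lambda>v. v) v"
      using sem_relax_round[OF s1(1) assms(2) s1(2,3)] by simp
    moreover have "loaded n k x es (sem ?p s1)"
      by (rule loaded_sem[OF s1(1)]) (auto simp: prog_defs)
    moreover have "arr (sem ?p s1) delA = arr s1 delA"
      by (rule arr_sem_unupdated) (simp add: prog_defs)
    ultimately show "I (Suc j) (sem ?p s1\<lparr>var := (var (sem ?p s1))(iV := Suc j)\<rparr>)"
      using s1(2) unfolding I_def by (auto intro!: loaded_var_update simp: holds_set_def)
  qed simp
  then show ?thesis using assms(1) by (simp add: I_def loaded_def relax_all_def)
qed

lemma sem_count_deleted:
  assumes "loaded n k x es s" "holds_set n delA D s"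
  shows "var (sem count_deleted s) dV = card D"
proof -
  define I where "I j s' \<longleftrightarrow> holds_set n delA D s' \<and> var s' dV = card (D \<inter> {..<j})" for j and s' :: env
  let ?p = "Assign dV (Plus (Var dV) (Arr delA (Var vV)))"
  let ?s = "s\<lparr>var := (var s)(dV := 0)\<rparr>"
  have "I (var ?s nV) (sem (For vV nV ?p) ?s)"
  proof (rule For_invariant)
    show "I 0 (?s\<lparr>var := (var ?s)(vV := 0)\<rparr>)"
      using assms(2) by (simp add: I_def holds_set_def)
  next
    fix j s1
    assume j: "j < var ?s nV" "var s1 vV = j" "I j s1"
    then have "arr s1 delA j = of_bool (j \<in> D)"
      using assms(1) by (simp add: I_def holds_set_def loaded_def)
    moreover have "D \<inter> {..<Suc j} = (if j \<in> D then insert j (D \<inter> {..<j}) else D \<inter> {..<j})"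
      by (auto simp: less_Suc_eq)
    ultimately show "I (Suc j) (sem ?p s1\<lparr>var := (var (sem ?p s1))(vV := Suc j)\<rparr>)"
      using j by (simp add: I_def holds_set_def)
  qed simp_all
  moreover have "D \<inter> {..<n} = D" using assms(2) by (auto simp: holds_set_def)
  ultimately show ?thesis using assms(1) by (simp add: I_def loaded_def count_deleted_def)
qed

lemma sem_count_pairs:
  assumes "loaded n k x es s" "\<forall>v<n. arr s labA v = l v"
  shows "var (sem count_pairs s) qV = card {(u, v). u < n \<and> v < n \<and> u \<noteq> v \<and> l u = l v}"
proof -
  let ?b = "\<lambda>u v. of_bool (u \<noteq> v \<and> l u = l v) :: nat"
  define p where "p = When (differ (Var uV) (Var vV))
    (When (Minus (Num 1) (differ (Arr labA (Var uV)) (Arr labA (Var vV))))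
      (Assign qV (Plus (Var qV) (Num 1))))"
  define I where "I j s' \<longleftrightarrow> var s' nV = n \<and> (\<forall>v<n. arr s' labA v = l v) \<and>
    var s' qV = (\<Sum>u<j. \<Sum>v<n. ?b u v)" for j and s' :: env
  let ?s = "s\<lparr>var := (var s)(qV := 0)\<rparr>"
  have "I (var ?s nV) (sem (For uV nV (For vV nV p)) ?s)"
  proof (rule For_invariant)
    show "uV \<notin> assigned (For vV nV p)" by (simp add: p_def)
    show "I 0 (?s\<lparr>var := (var ?s)(uV := 0)\<rparr>)"
      using assms by (simp add: I_def loaded_def)
  next
    fix j s1
    assume j: "j < var ?s nV" "var s1 uV = j" "I j s1"
    define J where "J i s' \<longleftrightarrow> var s' nV = n \<and> var s' uV = j \<and> (\<forall>v<n. arr s' labA v = l v) \<and>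
      var s' qV = (\<Sum>u<j. \<Sum>v<n. ?b u v) + (\<Sum>v<i. ?b j v)" for i and s' :: env
    have "j < n" using j(1) assms(1) by (simp add: loaded_def)
    have "J (var s1 nV) (sem (For vV nV p) s1)"
    proof (rule For_invariant)
      show "vV \<notin> assigned p" by (simp add: p_def)
      show "J 0 (s1\<lparr>var := (var s1)(vV := 0)\<rparr>)"
        using j(2,3) by (simp add: I_def J_def)
    next
      fix i s2
      assume i: "i < var s1 nV" "var s2 vV = i" "J i s2"
      then have "i < n" using j(3) by (simp add: I_def)
      then have "arr s2 labA i = l i" "arr s2 labA j = l j"
        using i(3) \<open>j < n\<close> by (auto simp: J_def)
      then show "J (Suc i) (sem p s2\<lparr>var := (var (sem p s2))(vV := Suc i)\<rparr>)"
        using i(2,3) by (auto simp: J_def p_def differ_def)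
    qed simp
    then show "I (Suc j) (sem (For vV nV p) s1\<lparr>var := (var (sem (For vV nV p) s1))(uV := Suc j)\<rparr>)"
      using j(3) by (simp add: I_def J_def)
  qed simp
  moreover have "(\<Sum>u<n. \<Sum>v<n. ?b u v) = card {(u, v). u < n \<and> v < n \<and> u \<noteq> v \<and> l u = l v}"
  proof -
    have "(\<Sum>u<n. \<Sum>v<n. ?b u v) = (\<Sum>e\<in>{..<n} \<times> {..<n}. of_bool (fst e \<noteq> snd e \<and> l (fst e) = l (snd e)))"
      by (simp only: sum.cartesian_product case_prod_unfold)
    also have "\<dots> = card (({..<n} \<times> {..<n}) \<inter> {e. fst e \<noteq> snd e \<and> l (fst e) = l (snd e)})"
      by simp
    also have "({..<n} \<times> {..<n}) \<inter> {e. fst e \<noteq> snd e \<and> l (fst e) = l (snd e)} =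
        {(u, v). u < n \<and> v < n \<and> u \<noteq> v \<and> l u = l v}"
      by auto
    finally show ?thesis .
  qed
  ultimately show ?thesis using assms(1) by (simp add: I_def loaded_def count_pairs_def p_def)
qed

definition successful :: "nat \<Rightarrow> nat \<Rightarrow> (nat \<times> nat) list \<Rightarrow> nat \<Rightarrow> bool" where
  "successful k x es t \<longleftrightarrow> (\<exists>D F r c. fold branch es ({}, {}, t, k + x) = (D, F, r, c) \<and>
    card D \<le> k \<and> card (linked (set es) D) \<le> x)"

lemma sem_try_string:
  assumes "loaded n k x es s" "set es \<subseteq> {..<n} \<times> {..<n}" "sym (set es)"
  shows "var (sem try_string s) yV = (if successful k x es (var s tV) then 1 else var s yV)"
proof -
  obtain D F r' c' where D: "fold branch es ({}, {}, var s tV, k + x) = (D, F, r', c')"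
    by (metis prod_cases4)
  define s1 where "s1 = sem reset s"
  define s2 where "s2 = sem branch_all s1"
  define s3 where "s3 = sem relax_all s2"
  define s4 where "s4 = sem count_deleted s3"
  define s5 where "s5 = sem count_pairs s4"
  have loaded1: "loaded n k x es s1"
    unfolding s1_def by (rule loaded_sem[OF assms(1)]) (auto simp: prog_defs)
  have loaded2: "loaded n k x es s2"
    unfolding s2_def by (rule loaded_sem[OF loaded1]) (auto simp: prog_defs)
  have loaded3: "loaded n k x es s3"
    unfolding s3_def by (rule loaded_sem[OF loaded2]) (auto simp: prog_defs)
  have loaded4: "loaded n k x es s4"
    unfolding s4_def by (rule loaded_sem[OF loaded3]) (auto simp: prog_defs)
  have loaded5: "loaded n k x es s5"
    unfolding s5_def by (rule loaded_sem[OF loaded4]) (auto simp: prog_defs)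
  have "var s1 tV = var s tV"
    unfolding s1_def by (rule var_sem_unassigned) (simp add: prog_defs)
  then have "fold branch es ({}, {}, var s1 tV, k + x) = (D, F, r', c')" using D by simp
  then have D2: "holds_set n delA D s2"
    unfolding s2_def
    by (rule sem_branch_all[OF loaded1 assms(2) sem_reset(1,2)[OF assms(1), folded s1_def]])
  have "arr s2 labA = arr s1 labA"
    unfolding s2_def by (rule arr_sem_unupdated) (simp add: prog_defs)
  then have "\<forall>v<n. arr s2 labA v = v"
    using sem_reset(3)[OF assms(1)] by (simp add: s1_def)
  define l where "l = (fold (relax D) es ^^ length es) (\<lambda>v. v)"
  have l3: "\<forall>v<n. arr s3 labA v = l v"
    unfolding s3_def l_def by (rule sem_relax_all) fact+
  have "arr s3 delA = arr s2 delA"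
    unfolding s3_def by (rule arr_sem_unupdated) (simp add: prog_defs)
  then have D3: "holds_set n delA D s3" using D2 by (simp add: holds_set_def)
  have "arr s4 labA = arr s3 labA"
    unfolding s4_def by (rule arr_sem_unupdated) (simp add: prog_defs)
  then have l4: "\<forall>v<n. arr s4 labA v = l v" using l3 by simp
  have "var s5 dV = var s4 dV"
    unfolding s5_def by (rule var_sem_unassigned) (simp add: prog_defs)
  then have d: "var s5 dV = card D"
    using sem_count_deleted[OF loaded3 D3] by (simp add: s4_def)
  \<comment> \<open>A nonempty path begins and ends with arcs, so \<open>linked\<close> relates only
    indices below \<open>n\<close> and the count misses no pair.\<close>
  have "{(u, v). u < n \<and> v < n \<and> u \<noteq> v \<and> l u = l v} = linked (set es) D"
  proof -
    have "linked (set es) D \<subseteq> {..<n} \<times> {..<n}"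
    proof -
      have "(Restr (set es) (- D))\<^sup>+ \<subseteq> {..<n} \<times> {..<n}"
        using assms(2) by (intro trancl_subset_Sigma) auto
      then show ?thesis using linked_subset_trancl by blast
    qed
    moreover have "l u = l v \<longleftrightarrow> (u, v) \<in> (Restr (set es) (- D))\<^sup>*" for u v
      unfolding l_def by (rule relax_labels[OF refl assms(3) card_length])
    ultimately show ?thesis unfolding linked_def by auto
  qed
  then have q: "var s5 qV = card (linked (set es) D)"
    using sem_count_pairs[OF loaded4 l4] by (simp add: s5_def)
  have "var s5 yV = var s yV"
    unfolding s5_def s4_def s3_def s2_def s1_def
    by (subst var_sem_unassigned, simp add: prog_defs)+ simp
  moreover have "var s5 kV = k" "var s5 xV = x" using loaded5 by (auto simp: loaded_def)
  moreover have "sem try_string s = sem decide s5"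
    by (simp add: try_string_def s1_def s2_def s3_def s4_def s5_def)
  ultimately show ?thesis using D by (simp add: decide_def d q successful_def)
qed

lemma sem_search:
  assumes "loaded n k x es s" "set es \<subseteq> {..<n} \<times> {..<n}" "sym (set es)"
  shows "var (sem search s) yV = of_bool (\<exists>t<3 ^ (k + x). successful k x es t)"
proof -
  define I where "I j s' \<longleftrightarrow> loaded n k x es s' \<and> var s' yV = of_bool (\<exists>t<j. successful k x es t)"
    for j and s' :: env
  let ?s = "s\<lparr>var := (var s)(yV := 0)\<rparr>"
  have s: "loaded n k x es ?s" using assms(1) by (intro loaded_var_update) auto
  have "I (var ?s pV) (sem (For tV pV try_string) ?s)"
  proof (rule For_invariant)
    show "tV \<notin> assigned try_string" by (simp add: prog_defs)
    show "I 0 (?s\<lparr>var := (var ?s)(tV := 0)\<rparr>)"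
      using loaded_var_update[OF s, of tV 0] by (simp add: I_def)
  next
    fix j s1
    assume j: "j < var ?s pV" "var s1 tV = j" "I j s1"
    then have s1: "loaded n k x es s1" by (simp add: I_def)
    have "loaded n k x es (sem try_string s1)"
      by (rule loaded_sem[OF s1]) (auto simp: prog_defs)
    then have "loaded n k x es
        (sem try_string s1\<lparr>var := (var (sem try_string s1))(tV := Suc j)\<rparr>)"
      by (rule loaded_var_update) simp
    then show "I (Suc j) (sem try_string s1\<lparr>var := (var (sem try_string s1))(tV := Suc j)\<rparr>)"
      using sem_try_string[OF s1 assms(2,3)] j(2,3) by (auto simp: I_def less_Suc_eq)
  qed simp
  then show ?thesis using s by (simp add: I_def search_def loaded_def)
qed


section \<open>Reading the input and building the tables\<close>

lemma sem_read_params: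
  "sem read_params (init_env (n # k # x # w)) =
    \<lparr>inp = w, var = (\<lambda>_. 0)(nV := n, kV := k, xV := x, lV := k + x, pV := 1),
      arr = (\<lambda>_ _. 0)(powA := (\<lambda>_. 0)(0 := 1))\<rparr>"
  by (simp add: read_params_def init_env_def fun_eq_iff)

lemma sem_powers:
  assumes "var s pV = 1" "arr s powA 0 = 1"
  shows "\<forall>i\<le>var s lV. arr (sem powers s) powA i = 3 ^ i" "var (sem powers s) pV = 3 ^ var s lV"
    "inp (sem powers s) = inp s"
proof -
  let ?I = "\<lambda>j s'. (\<forall>i\<le>j. arr s' powA i = 3 ^ i) \<and> var s' pV = 3 ^ j \<and> inp s' = inp s"
  have "?I (var s lV) (sem powers s)"
    unfolding powers_def by (rule For_invariant) (auto simp: assms le_Suc_eq)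
  then show "\<forall>i\<le>var s lV. arr (sem powers s) powA i = 3 ^ i"
    "var (sem powers s) pV = 3 ^ var s lV" "inp (sem powers s) = inp s" by auto
qed

text \<open>Rows and columns are parameters, here and in \<open>edge_list\<close>, so that partly
  read matrices can be described by the loop invariants.\<close>

abbreviation bits :: "(nat \<times> nat) set \<Rightarrow> nat list \<Rightarrow> nat list \<Rightarrow> nat list" where
  "bits E us vs \<equiv> [if (u, v) \<in> E then 1 else 0. u \<leftarrow> us, v \<leftarrow> vs]"

definition edge_list :: "(nat \<times> nat) set \<Rightarrow> nat list \<Rightarrow> nat list \<Rightarrow> (nat \<times> nat) list" where
  "edge_list E us vs = filter (\<lambda>e. e \<in> E) (List.product us vs)"

definition stores_edges :: "(nat \<times> nat) list \<Rightarrow> env \<Rightarrow> bool" where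
  "stores_edges es s \<longleftrightarrow> var s mV = length es \<and>
    (\<forall>i<length es. arr s srcA i = fst (es ! i) \<and> arr s tgtA i = snd (es ! i))"

lemma sem_read_edges:
  assumes "inp s = bits E [0..<n] [0..<n]" "var s nV = n"
  shows "stores_edges (edge_list E [0..<n] [0..<n]) (sem read_edges s)"
proof -
  define p where "p = Input bV ;;
    When (Var bV) (
      Update srcA (Var mV) (Var uV) ;; Update tgtA (Var mV) (Var vV) ;;
      Assign mV (Plus (Var mV) (Num 1)))"
  define I where "I j s' \<longleftrightarrow> var s' nV = n \<and> inp s' = bits E [j..<n] [0..<n] \<and>
    stores_edges (edge_list E [0..<j] [0..<n]) s'" for j and s' :: env
  let ?s = "s\<lparr>var := (var s)(mV := 0)\<rparr>"
  have "I (var ?s nV) (sem (For uV nV (For vV nV p)) ?s)"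
  proof (rule For_invariant)
    show "uV \<notin> assigned (For vV nV p)" by (simp add: p_def)
    show "I 0 (?s\<lparr>var := (var ?s)(uV := 0)\<rparr>)"
      using assms by (simp add: I_def edge_list_def stores_edges_def)
  next
    fix j s1
    assume j: "j < var ?s nV" "var s1 uV = j" "I j s1"
    define es where "es = edge_list E [0..<j] [0..<n]"
    \<comment> \<open>Inside row \<open>j\<close> the unread input is the rest of this row followed
      by the later rows.\<close>
    define J where "J i s' \<longleftrightarrow> var s' nV = n \<and> var s' uV = j \<and>
      inp s' = bits E [j] [i..<n] @ bits E [Suc j..<n] [0..<n] \<and>
      stores_edges (es @ edge_list E [j] [0..<i]) s'" for i and s' :: env
    have "j < n" using j(1) assms(2) by simp
    then have "[j..<n] = j # [Suc j..<n]" by (rule upt_conv_Cons)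
    then have "J 0 (s1\<lparr>var := (var s1)(vV := 0)\<rparr>)"
      using j by (simp add: I_def J_def es_def edge_list_def stores_edges_def)
    have "J (var s1 nV) (sem (For vV nV p) s1)"
    proof (rule For_invariant)
      show "vV \<notin> assigned p" by (simp add: p_def)
      show "J 0 (s1\<lparr>var := (var s1)(vV := 0)\<rparr>)" by fact
    next
      fix i s2
      assume i: "i < var s1 nV" "var s2 vV = i" "J i s2"
      then have "i < n" using j(3) by (simp add: I_def)
      then have "[i..<n] = i # [Suc i..<n]" by (rule upt_conv_Cons)
      then have inp: "inp s2 = (if (j, i) \<in> E then 1 else 0) # bits E [j] [Suc i..<n] @ bits E [Suc j..<n] [0..<n]"
        using i(3) by (simp add: J_def)
      have edges: "edge_list E [j] [0..<Suc i] = edge_list E [j] [0..<i] @ (if (j, i) \<in> E then [(j, i)] else [])"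
        by (simp add: edge_list_def)
      have stored: "stores_edges (es @ edge_list E [j] [0..<i]) s2" using i(3) by (simp add: J_def)
      let ?s = "sem p s2\<lparr>var := (var (sem p s2))(vV := Suc i)\<rparr>"
      have "stores_edges (es @ edge_list E [j] [0..<Suc i]) ?s"
      proof (cases "(j, i) \<in> E")
        case True
        then show ?thesis
          using i(2,3) stored unfolding edges
          by (auto simp: J_def p_def inp stores_edges_def nth_append less_Suc_eq)
      next
        case False
        then show ?thesis
          using stored unfolding edges by (simp add: p_def inp stores_edges_def)
      qed
      moreover have "inp ?s = bits E [j] [Suc i..<n] @ bits E [Suc j..<n] [0..<n]"
        by (simp add: p_def inp)
      moreover have "var ?s nV = n" "var ?s uV = j"
        using i(3) by (simp_all add: J_def p_def)
      ultimately show "J (Suc i) ?s" by (simp add: J_def)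
    qed simp
    moreover have "edge_list E [0..<Suc j] [0..<n] = es @ edge_list E [j] [0..<n]"
      by (simp add: edge_list_def es_def product_concat_map)
    ultimately show "I (Suc j) (sem (For vV nV p) s1\<lparr>var := (var (sem (For vV nV p) s1))(uV := Suc j)\<rparr>)"
      using j(3) by (simp add: I_def J_def stores_edges_def)
  qed simp
  then show ?thesis using assms by (simp add: I_def read_edges_def p_def)
qed

lemma loaded_initial:
  assumes "w = n # k # x # bits E [0..<n] [0..<n]"
  shows "loaded n k x (edge_list E [0..<n] [0..<n])
    (sem read_edges (sem powers (sem read_params (init_env w))))"
proof -
  define s0 where "s0 = sem read_params (init_env w)"
  define s1 where "s1 = sem powers s0"
  have s0: "var s0 nV = n" "var s0 kV = k" "var s0 xV = x" "var s0 lV = k + x" "var s0 pV = 1"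
    "arr s0 powA 0 = 1" "inp s0 = bits E [0..<n] [0..<n]"
    unfolding s0_def assms sem_read_params by simp_all
  have v1: "var s1 i = var s0 i" if "i < 4" for i
    unfolding s1_def using that by (intro var_sem_unassigned) (auto simp: prog_defs)
  have s1: "\<forall>i\<le>k + x. arr s1 powA i = 3 ^ i" "var s1 pV = 3 ^ (k + x)" "inp s1 = inp s0"
    using sem_powers[of s0] s0 by (simp_all add: s1_def)
  have v2: "var (sem read_edges s1) i = var s1 i" if "i < 5" for i
    using that by (intro var_sem_unassigned) (auto simp: prog_defs)
  have "arr (sem read_edges s1) powA = arr s1 powA"
    by (intro arr_sem_unupdated) (auto simp: prog_defs)
  moreover have "stores_edges (edge_list E [0..<n] [0..<n]) (sem read_edges s1)"
    by (rule sem_read_edges) (use s1 s0 v1 in auto)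
  ultimately show ?thesis
    using v1 v2 s0 s1 by (simp add: loaded_def stores_edges_def s0_def s1_def)
qed

lemma sem_cnc_prog:
  assumes "w = n # k # x # bits E [0..<n] [0..<n]" "E \<subseteq> {..<n} \<times> {..<n}" "sym E"
  shows "arr (sem cnc_prog (init_env w)) 0 0 =
    of_bool (\<exists>t<3 ^ (k + x). successful k x (edge_list E [0..<n] [0..<n]) t)"
proof -
  have "set (edge_list E [0..<n] [0..<n]) = E"
    using assms(2) by (auto simp: edge_list_def)
  then have "set (edge_list E [0..<n] [0..<n]) \<subseteq> {..<n} \<times> {..<n}"
    "sym (set (edge_list E [0..<n] [0..<n]))"
    using assms by auto
  from sem_search[OF loaded_initial[OF assms(1)] this] show ?thesis
    by (simp add: cnc_prog_def)
qed


section \<open>Running time\<close>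

text \<open>The summand 100 covers the additive constants: 50 for reading the parameters and writing
  the answer, and 10 + 11 for administering the search loop.\<close>

definition cost_factor :: nat where
  "cost_factor = 100 + cost_bound powers (\<lambda>_. 1) + cost_bound read_edges (\<lambda>_. 1) +
    cost_bound try_string (\<lambda>_. 1)"

lemma cost_cnc_prog:
  assumes "w = n # k # x # bits E [0..<n] [0..<n]"
  shows "cost cnc_prog (init_env w) \<le> cost_factor * 3 ^ (k + x) * (n + 1) ^ 4"
proof -
  define s0 where "s0 = sem read_params (init_env w)"
  define s1 where "s1 = sem powers s0"
  define s2 where "s2 = sem read_edges s1"
  \<comment> \<open>\<open>?M\<close> bounds both \<open>n\<close> and the number of arcs, so loops
    of depth 2 cost \<open>?M ^ 2 = (n + 1) ^ 4\<close> up to a constant.\<close>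
  let ?M = "(n + 1) ^ 2" and ?P = "3 ^ (k + x) :: nat" and ?es = "edge_list E [0..<n] [0..<n]"
  have s0: "var s0 nV = n" "var s0 lV = k + x"
    unfolding s0_def assms sem_read_params by simp_all
  have s1: "var s1 nV = n"
    unfolding s1_def using s0(1) by (subst var_sem_unassigned) (auto simp: prog_defs)
  have s2: "loaded n k x ?es s2"
    using loaded_initial[OF assms] by (simp add: s0_def s1_def s2_def)
  have "n \<le> ?M" by (simp add: power2_eq_square)
  have "length ?es \<le> ?M"
  proof -
    have "length ?es \<le> length (List.product [0..<n] [0..<n])"
      unfolding edge_list_def by (rule length_filter_le)
    then show ?thesis by (simp add: power2_eq_square)
  qed
  \<comment> \<open>The table of powers takes \<open>k + x\<close> rounds, charged to the parameter
    factor.\<close>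
  have "a < 3 ^ a" for a :: nat by (induction a) auto
  then have "k + x \<le> ?P" by (simp add: less_imp_le)
  have "cost powers s0 \<le> cost_bound powers (var s0)"
    by (rule cost_le_cost_bound) (simp add: prog_defs)
  also have "\<dots> \<le> cost_bound powers (\<lambda>_. 1) * ?P ^ loop_depth powers"
    by (rule cost_bound_le_power) (use s0 \<open>k + x \<le> ?P\<close> in \<open>simp_all add: prog_defs\<close>)
  also have "loop_depth powers = 1" by (simp add: prog_defs)
  finally have powers: "cost powers s0 \<le> cost_bound powers (\<lambda>_. 1) * ?P" by simp
  have "cost read_edges s1 \<le> cost_bound read_edges (var s1)"
    by (rule cost_le_cost_bound) (simp add: prog_defs)
  also have "\<dots> \<le> cost_bound read_edges (\<lambda>_. 1) * ?M ^ loop_depth read_edges"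
    by (rule cost_bound_le_power) (use s1 \<open>n \<le> ?M\<close> in \<open>auto simp: prog_defs\<close>)
  also have "loop_depth read_edges = 2" by (simp add: prog_defs)
  finally have read: "cost read_edges s1 \<le> cost_bound read_edges (\<lambda>_. 1) * ?M ^ 2" .
  have "cost search s2 \<le> cost_bound search (var s2)"
    by (rule cost_le_cost_bound) (simp add: prog_defs)
  \<comment> \<open>The loop over the strings is unfolded by hand, since its count is not bounded by
    \<open>?M\<close>. Each round adds 6 steps for the increment and 4 for the loop; 11 is two
    assignments of 3 steps plus 5 for entry and exit.\<close>
  also have "\<dots> = ?P * (cost_bound try_string (var s2) + 10) + 11"
    using s2 by (simp add: search_def For_def loaded_def)
  also have "cost_bound try_string (var s2) \<le> cost_bound try_string (\<lambda>_. 1) * ?M ^ loop_depth try_string"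
    by (rule cost_bound_le_power)
      (use s2 \<open>n \<le> ?M\<close> \<open>length ?es \<le> ?M\<close> in \<open>auto simp: prog_defs loaded_def\<close>)
  also have "loop_depth try_string = 2" by (simp add: prog_defs)
  finally have search: "cost search s2 \<le> ?P * (cost_bound try_string (\<lambda>_. 1) * ?M ^ 2 + 10) + 11"
    by simp
  have "cost cnc_prog (init_env w) \<le> 50 + cost powers s0 + cost read_edges s1 + cost search s2"
    by (simp add: cnc_prog_def s0_def s1_def s2_def) (simp add: read_params_def)
  also have "\<dots> \<le> cost_factor * (?P * ?M ^ 2)"
  proof -
    define Q where "Q = ?P * ?M ^ 2"
    have "?P * 1 \<le> Q" "1 * ?M ^ 2 \<le> Q"
      unfolding Q_def by (rule mult_le_mono; simp)+
    then have le: "?P \<le> Q" "?M ^ 2 \<le> Q" "1 \<le> Q"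
      using one_le_power[of "3 :: nat" "k + x"] by linarith+
    have "cost powers s0 \<le> cost_bound powers (\<lambda>_. 1) * Q"
      using powers mult_le_mono2[OF le(1)] by (rule order_trans)
    moreover have "cost read_edges s1 \<le> cost_bound read_edges (\<lambda>_. 1) * Q"
      using read mult_le_mono2[OF le(2)] by (rule order_trans)
    moreover have "cost search s2 \<le> cost_bound try_string (\<lambda>_. 1) * Q + 10 * ?P + 11"
      using search by (simp add: Q_def algebra_simps)
    moreover have "cost_factor * Q = 100 * Q + cost_bound powers (\<lambda>_. 1) * Q +
        cost_bound read_edges (\<lambda>_. 1) * Q + cost_bound try_string (\<lambda>_. 1) * Q"
      by (simp only: cost_factor_def distrib_right)
    ultimately show ?thesis using le unfolding Q_def[symmetric] by linarith
  qed
  also have "?M ^ 2 = (n + 1) ^ 4" by (simp flip: power_mult)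
  finally show ?thesis by (simp add: mult.assoc)
qed

text \<open>The compiler serves here too: repeated tripling is a loop program, and its
  \<open>cost\<close> is the required number of steps.\<close>

lemma computable_exponential: "computable (\<lambda>a. c * 3 ^ a)"
proof -
  let ?b = "Assign 0 (Plus (Var 0) (Plus (Var 0) (Var 0)))"
  let ?p = "Input 1 ;; Assign 0 (Num c) ;; Repeat 1 ?b ;; Update 0 (Num 0) (Var 0)"
  have "var ((sem ?b ^^ i) s) 0 = var s 0 * 3 ^ i" for i s
    by (induction i) auto
  then have "arr (sem ?p (init_env [a])) 0 0 = c * 3 ^ a" for a
    by (simp add: init_env_def)
  moreover have "prog_ok ?p" by simp
  ultimately have "computes_in (code ?p 0 0) [a] (cost ?p (init_env [a])) (c * 3 ^ a)" for a
    using computes_in_code[of ?p "[a]", OF _ order_refl] by simp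
  then show ?thesis unfolding computable_def by blast
qed


theorem theorem3:
  shows "fixed_parameter_tractable cnc_instances cnc_encode cnc_parameter cnc_size cnc"
  unfolding fixed_parameter_tractable_def
proof (intro exI conjI ballI)
  show "computable (\<lambda>a. cost_factor * 3 ^ a)" by (rule computable_exponential)
  fix i assume i: "i \<in> cnc_instances"
  obtain G k x where Gkx: "i = (G, k, x)" by (cases i)
  define n where "n = card (pverts G)"
  have "pair_graph G \<and> pverts G = {..<card (pverts G)}"
    using i unfolding cnc_instances_def Gkx mem_Collect_eq prod.case .
  then have G: "pair_graph G" "pverts G = {..<n}"
    unfolding n_def[symmetric] by (rule conjunct1, rule conjunct2)
  let ?E = "parcs G" and ?es = "edge_list (parcs G) [0..<n] [0..<n]"
  have E: "?E \<subseteq> {..<n} \<times> {..<n}"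
    using pair_graph.parcs_subset[OF G(1)] unfolding G(2) .
  have "sym ?E" by (rule pair_graph.sym_parcs[OF G(1)])
  have "irrefl ?E" by (rule pair_graph.irrefl_parcs[OF G(1)])
  have set_es: "set ?es = ?E" using E by (auto simp: edge_list_def)
  have enc: "cnc_encode i = n # k # x # bits ?E [0..<n] [0..<n]"
    by (simp add: Gkx n_def Let_def)
  have "i \<in> cnc \<longleftrightarrow> (\<exists>C\<subseteq>{..<n}. card C \<le> k \<and> card (linked ?E C) \<le> x)"
  proof -
    have "i \<in> cnc \<longleftrightarrow> (\<exists>C\<subseteq>pverts G. card C \<le> k \<and>
        card (connected_pairs (with_proj G \<restriction> (pverts G - C))) \<le> x)"
      using i unfolding Gkx cnc_def mem_Collect_eq prod.case by (simp only: simp_thms)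
    then show ?thesis using connected_pairs_delete[OF G(1)] G(2) by (metis (no_types, lifting))
  qed
  also have "\<dots> \<longleftrightarrow> (\<exists>t<3 ^ (k + x). successful k x ?es t)"
  proof
    assume "\<exists>C\<subseteq>{..<n}. card C \<le> k \<and> card (linked ?E C) \<le> x"
    then obtain C where C: "C \<subseteq> {..<n}" "card C \<le> k" "card (linked ?E C) \<le> x" by blast
    then have "finite C" by (auto intro: finite_subset)
    from branch_complete[OF set_es \<open>sym ?E\<close> \<open>irrefl ?E\<close> this C(2,3)]
    show "\<exists>t<3 ^ (k + x). successful k x ?es t"
      unfolding successful_def set_es by blast
  next
    assume "\<exists>t<3 ^ (k + x). successful k x ?es t"
    then obtain t D F r c where D: "fold branch ?es ({}, {}, t, k + x) = (D, F, r, c)"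
      "card D \<le> k" "card (linked ?E D) \<le> x"
      unfolding successful_def set_es by blast
    have "D \<subseteq> Field ?E" using fold_branch_subset[OF D(1)] by (simp add: set_es)
    also have "\<dots> \<subseteq> {..<n}" using E by (auto simp: Field_def)
    finally show "\<exists>C\<subseteq>{..<n}. card C \<le> k \<and> card (linked ?E C) \<le> x"
      using D(2,3) by blast
  qed
  finally have "(if i \<in> cnc then 1 else 0) = arr (sem cnc_prog (init_env (cnc_encode i))) 0 0"
    using sem_cnc_prog[OF enc E \<open>sym ?E\<close>] by simp
  moreover have "cost cnc_prog (init_env (cnc_encode i))
      \<le> cost_factor * 3 ^ cnc_parameter i * (cnc_size i + 1) ^ 4"
    using cost_cnc_prog[OF enc] by (simp add: Gkx n_def)
  moreover have "prog_ok cnc_prog" by (simp add: prog_defs)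
  ultimately show "computes_in (code cnc_prog 0 0) (cnc_encode i)
      (cost_factor * 3 ^ cnc_parameter i * (cnc_size i + 1) ^ 4) (if i \<in> cnc then 1 else 0)"
    using computes_in_code by simp
qed

end
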